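(* Let $0<s\le t<\infty$, and let $\{Z_2(t)\}_{t\ge0}$ be the compound Poisson process of order $k$ time-changed by the first exit time of the mixture of tempered stable subordinators, $Z_2(t)=Z(E(t))$, denoted $TCPPoK(\lambda,H,E_{\alpha_1,\alpha_2}^{\mu_1,\mu_2})$, where $E(t)=E_{\alpha_1,\alpha_2}^{\mu_1,\mu_2}(t)$; let $Y$ denote a random variable with distribution function $H$. Then the mean and covariance function of $\{Z_2(t)\}_{t\ge0}$ are given by: (i) $\mathbb{E}[Z_2(t)]=\frac{k(k+1)}{2}\,\lambda\,\mathbb{E}[Y]\,\mathbb{E}[E(t)]$; (ii) $\mathrm{Cov}[Z_2(s),Z_2(t)]=\mathrm{Var}[Z(1)]\,\mathbb{E}[E(s)]+(\mathbb{E}[Z(1)])^2\,\mathrm{Cov}[E(s),E(t)]$.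
   Context: Fix an integer $k\ge1$ and $\lambda>0$. Poisson process of order $k$, $PPoK(\lambda)$: $N^{(k)}(t)=\sum_{i=1}^{N(t)}X_i$, where $\{N(t)\}_{t\ge0}$ is a Poisson process with rate $k\lambda$ and $\{X_i\}_{i\ge1}$ are i.i.d. discrete uniform on $\{1,\dots,k\}$, independent of $\{N(t)\}$. Compound Poisson process of order $k$, $CPPoK(\lambda,H)$: $Z(t)=\sum_{i=1}^{N^{(k)}(t)}Y_i$, where $\{N^{(k)}(t)\}_{t\ge0}$ is $PPoK(\lambda)$ and $\{Y_i\}_{i\ge1}$ are i.i.d. random variables with cumulative distribution function $H$, independent of $\{N^{(k)}(t)\}$. Mixture of tempered stable subordinators (MTSS): $\{S_{\alpha_1,\alpha_2}^{\mu_1,\mu_2}(t)\}_{t\ge0}$ is the Lévy subordinator (one-dimensional non-decreasing Lévy process) with $$\mathbb{E}[e^{-uS_{\alpha_1,\alpha_2}^{\mu_1,\mu_2}(t)}]=\exp\{-t(c_1((u+\mu_1)^{\alpha_1}-\mu_1^{\alpha_1})+c_2((u+\mu_2)^{\alpha_2}-\mu_2^{\alpha_2}))\},\quad u>0,$$ where $c_1,c_2\ge0$, $c_1+c_2=1$, $\mu_1,\mu_2>0$, $\alpha_1,\alpha_2\in(0,1)$. First exit time (inverse subordinator): $E_{\alpha_1,\alpha_2}^{\mu_1,\mu_2}(t)=\inf\{r\ge0:S_{\alpha_1,\alpha_2}^{\mu_1,\mu_2}(r)>t\}$, $t\ge0$. $TCPPoK(\lambda,H,E_{\alpha_1,\alpha_2}^{\mu_1,\mu_2})$: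 $Z_2(t)=Z(E_{\alpha_1,\alpha_2}^{\mu_1,\mu_2}(t))$, where $\{Z(t)\}_{t\ge0}$ is $CPPoK(\lambda,H)$, independent of $\{E_{\alpha_1,\alpha_2}^{\mu_1,\mu_2}(t)\}_{t\ge0}$. *)

theory Defs
  imports "HOL-Probability.Probability"
begin

definition square_integrable :: "'a measure \<Rightarrow> ('a \<Rightarrow> real) \<Rightarrow> bool" where
  "square_integrable M X \<longleftrightarrow> X \<in> borel_measurable M \<and> integrable M (\<lambda>\<omega>. (X \<omega>)\<^sup>2)"

definition covariance :: "'a measure \<Rightarrow> ('a \<Rightarrow> real) \<Rightarrow> ('a \<Rightarrow> real) \<Rightarrow> real" where
  "covariance M X Y =
     (\<integral>\<omega>. (X \<omega> - (\<integral>x. X x \<partial>M)) * (Y \<omega> - (\<integral>x. Y x \<partial>M)) \<partial>M)"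

text \<open>Independence of two families of random variables as families, i.e. of the sigma-algebras
  they generate. Measurability of every member of both families is part of the notion,
  as \<^const>\<open>prob_space.indep_set\<close> requires both sigma-algebras to consist of events.\<close>

definition indep_families ::
  "'a measure \<Rightarrow> 'i set \<Rightarrow> ('i \<Rightarrow> 'a \<Rightarrow> 'b::topological_space) \<Rightarrow>
   'j set \<Rightarrow> ('j \<Rightarrow> 'a \<Rightarrow> 'c::topological_space) \<Rightarrow> bool" where
  "indep_families M I X J Y \<longleftrightarrow>
     prob_space.indep_set M
       (sets (vimage_algebra (space M) (\<lambda>\<omega>. \<lambda>i\<in>I. X i \<omega>) (PiM I (\<lambda>_. borel))))
       (sets (vimage_algebra (space M) (\<lambda>\<omega>. \<lambda>j\<in>J. Y j \<omega>) (PiM J (\<lambda>_. borel))))"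

text \<open>Processes are indexed by \<^typ>\<open>real\<close>; only the times \<open>t \<ge> 0\<close> matter. The path properties hold
  almost surely. Stochastic continuity follows from right-continuity and stationarity.\<close>

definition levy_process :: "'a measure \<Rightarrow> (real \<Rightarrow> 'a \<Rightarrow> real) \<Rightarrow> bool" where
  "levy_process M X \<longleftrightarrow>
     (\<forall>t\<ge>0. X t \<in> borel_measurable M) \<and>
     (AE \<omega> in M. X 0 \<omega> = 0) \<and>
     (\<forall>\<tau>::nat \<Rightarrow> real. 0 \<le> \<tau> 0 \<and> mono \<tau> \<longrightarrow>
        (\<forall>n. prob_space.indep_vars M (\<lambda>_. borel)
               (\<lambda>i \<omega>. X (\<tau> (Suc i)) \<omega> - X (\<tau> i) \<omega>) {..<n})) \<and>
     (\<forall>s\<ge>0. \<forall>h\<ge>0. distr M borel (\<lambda>\<omega>. X (s + h) \<omega> - X s \<omega>) =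
                    distr M borel (\<lambda>\<omega>. X h \<omega> - X 0 \<omega>)) \<and>
     (AE \<omega> in M. (\<forall>t\<ge>0. continuous (at_right t) (\<lambda>r. X r \<omega>)) \<and>
                 (\<forall>t>0. \<exists>l. ((\<lambda>r. X r \<omega>) \<longlongrightarrow> l) (at_left t)))"

text \<open>\<open>t = 0\<close> is excluded below because \<^const>\<open>poisson_pmf\<close> is only specified for positive rates;
  \<open>N 0 = 0\<close> almost surely is part of \<^const>\<open>levy_process\<close>.\<close>

definition poisson_process :: "'a measure \<Rightarrow> real \<Rightarrow> (real \<Rightarrow> 'a \<Rightarrow> nat) \<Rightarrow> bool" where
  "poisson_process M r N \<longleftrightarrow>
     levy_process M (\<lambda>t \<omega>. real (N t \<omega>)) \<and>
     (\<forall>t>0. distr M (count_space UNIV) (N t) = measure_pmf (poisson_pmf (r * t)))"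

definition PPoK :: "'a measure \<Rightarrow> nat \<Rightarrow> real \<Rightarrow> (real \<Rightarrow> 'a \<Rightarrow> nat) \<Rightarrow> bool" where
  "PPoK M k lam Nk \<longleftrightarrow>
     (\<exists>N X. poisson_process M (real k * lam) N \<and>
        prob_space.indep_vars M (\<lambda>_. count_space UNIV) X {1::nat..} \<and>
        (\<forall>i\<ge>1. distr M (count_space UNIV) (X i) = measure_pmf (pmf_of_set {1..k})) \<and>
        indep_families M {1..} X {0..} N \<and>
        (\<forall>t\<ge>0. \<forall>\<omega>\<in>space M. Nk t \<omega> = (\<Sum>i=1..N t \<omega>. X i \<omega>)))"

definition CPPoK ::
  "'a measure \<Rightarrow> nat \<Rightarrow> real \<Rightarrow> (real \<Rightarrow> real) \<Rightarrow> (real \<Rightarrow> 'a \<Rightarrow> real) \<Rightarrow> bool" where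
  "CPPoK M k lam H Z \<longleftrightarrow>
     (\<exists>Nk Y. PPoK M k lam Nk \<and>
        prob_space.indep_vars M (\<lambda>_. borel) Y {1::nat..} \<and>
        (\<forall>i\<ge>1. cdf (distr M borel (Y i)) = H) \<and>
        indep_families M {1..} Y {0..} Nk \<and>
        (\<forall>t\<ge>0. \<forall>\<omega>\<in>space M. Z t \<omega> = (\<Sum>i=1..Nk t \<omega>. Y i \<omega>)))"

definition subordinator :: "'a measure \<Rightarrow> (real \<Rightarrow> 'a \<Rightarrow> real) \<Rightarrow> bool" where
  "subordinator M S \<longleftrightarrow> levy_process M S \<and> (AE \<omega> in M. mono_on {0..} (\<lambda>t. S t \<omega>))"

definition MTSS ::
  "'a measure \<Rightarrow> real \<Rightarrow> real \<Rightarrow> real \<Rightarrow> real \<Rightarrow> real \<Rightarrow> real \<Rightarrow> (real \<Rightarrow> 'a \<Rightarrow> real) \<Rightarrow> bool" where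
  "MTSS M c\<^sub>1 c\<^sub>2 \<alpha>\<^sub>1 \<alpha>\<^sub>2 \<mu>\<^sub>1 \<mu>\<^sub>2 S \<longleftrightarrow>
     subordinator M S \<and>
     (\<forall>t\<ge>0. \<forall>u>0. (\<integral>\<omega>. exp (- u * S t \<omega>) \<partial>M) =
        exp (- t * (c\<^sub>1 * ((u + \<mu>\<^sub>1) powr \<alpha>\<^sub>1 - \<mu>\<^sub>1 powr \<alpha>\<^sub>1) +
                    c\<^sub>2 * ((u + \<mu>\<^sub>2) powr \<alpha>\<^sub>2 - \<mu>\<^sub>2 powr \<alpha>\<^sub>2))))"

text \<open>For the subordinators above the set is almost surely nonempty, so the (unspecified) value of
  \<^term>\<open>Inf {} :: real\<close> is irrelevant.\<close>

definition first_exit :: "(real \<Rightarrow> 'a \<Rightarrow> real) \<Rightarrow> real \<Rightarrow> 'a \<Rightarrow> real" where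
  "first_exit S t \<omega> = Inf {r. 0 \<le> r \<and> S r \<omega> > t}"

text \<open>\<open>Z2\<close> is the process \<open>Z\<close> run at the random times \<open>E\<close>. Since paths are only almost surely
  right-continuous and \<open>M\<close> need not be complete, it has to be said that \<open>Z2\<close> is a stochastic
  process, i.e. that each \<open>Z2 t\<close> is measurable.\<close>

definition TCPPoK ::
  "'a measure \<Rightarrow> nat \<Rightarrow> real \<Rightarrow> (real \<Rightarrow> real) \<Rightarrow> (real \<Rightarrow> 'a \<Rightarrow> real) \<Rightarrow>
   (real \<Rightarrow> 'a \<Rightarrow> real) \<Rightarrow> (real \<Rightarrow> 'a \<Rightarrow> real) \<Rightarrow> bool" where
  "TCPPoK M k lam H E Z Z2 \<longleftrightarrow>
     CPPoK M k lam H Z \<and>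
     indep_families M {0..} Z {0..} E \<and>
     (\<forall>t\<ge>0. Z2 t \<in> borel_measurable M) \<and>
     (\<forall>t\<ge>0. \<forall>\<omega>\<in>space M. Z2 t \<omega> = Z (E t \<omega>) \<omega>)"

end

theory Submission
  imports Defs
begin

text \<open>A process \<open>W\<close> with \<open>E W(r) = m r\<close> and \<open>E [W(r) W(r')] = A min(r, r') + m\<^sup>2 r r'\<close> keeps such moments
  under two operations. If an independent natural-valued process \<open>N\<close> has them, conditioning on \<open>N\<close>
  gives them for the random sums of an i.i.d. sequence up to \<open>N(r)\<close>; applied twice, this passes from
  the Poisson process to \<open>Z\<close>. If \<open>T \<le> T'\<close> are random times independent of \<open>W\<close>, then
  \<open>E W(T) = m E T\<close> and \<open>E [W(T) W(T')] = A E T + m\<^sup>2 E [T T']\<close>: this is conditioning for times with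
  countably many values, and the general case follows by approximating the times from the right by
  grid points, because the moments bound the \<open>L\<^sup>1\<close> and \<open>L\<^sup>2\<close> increments of \<open>W\<close> and Fatou's lemma
  turns right-continuity of the paths into \<open>L\<^sup>1\<close> and \<open>L\<^sup>2\<close> convergence.
  The first exit time is square integrable since \<open>P(S(n) \<le> t) \<le> e\<^sup>t E [exp(-S(n))]\<close> decays
  geometrically in \<open>n\<close>.\<close>

section \<open>Independence and random indices\<close>

text \<open>The obstacle is measurability: on the product sigma-algebra over all real times,
  evaluating a path at a time is not jointly measurable in path and time, so Fubini cannot be
  applied to \<open>W (T \<omega>) \<omega>\<close> with a real-valued \<open>T\<close>. With a
  countable index it can, which is why random sums are treated exactly and random times only after
  discretization. Two separate moment conditions are carried along because the mean formula is
  claimed for merely integrable \<open>Y\<close>; there the control of increments must come from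
  first absolute moments. The constant \<open>A\<close> stays anonymous until the end, where the
  moments at time 1 identify it as the variance of \<open>Z 1\<close>; hence the second moment of
  the uniform law is never evaluated. Nor is \<open>Z\<close> shown to be a Levy process: its first
  two moments and the right-continuity of its paths carry the argument.\<close>

text \<open>The library notion \<^const>\<open>prob_space.indep_var\<close> forces both variables to have the same type,
  which excludes pairs such as a real process and a natural-valued index.\<close>

definition indep_pair ::
  "'a measure \<Rightarrow> 'b measure \<Rightarrow> ('a \<Rightarrow> 'b) \<Rightarrow> 'c measure \<Rightarrow> ('a \<Rightarrow> 'c) \<Rightarrow> bool" where
  "indep_pair M S X T Y \<longleftrightarrow> X \<in> M \<rightarrow>\<^sub>M S \<and> Y \<in> M \<rightarrow>\<^sub>M T \<and>
     (\<forall>A\<in>sets S. \<forall>B\<in>sets T.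
        measure M ((X -` A \<inter> space M) \<inter> (Y -` B \<inter> space M)) =
        measure M (X -` A \<inter> space M) * measure M (Y -` B \<inter> space M))"

lemma indep_pair_measurable:
  assumes "indep_pair M S X T Y"
  shows "X \<in> M \<rightarrow>\<^sub>M S" "Y \<in> M \<rightarrow>\<^sub>M T"
  using assms by (auto simp: indep_pair_def)

lemma indep_pair_compose:
  assumes ind: "indep_pair M S X T Y" and f: "f \<in> S \<rightarrow>\<^sub>M S'" and g: "g \<in> T \<rightarrow>\<^sub>M T'"
  shows "indep_pair M S' (\<lambda>\<omega>. f (X \<omega>)) T' (\<lambda>\<omega>. g (Y \<omega>))"
proof -
  have X: "X \<in> M \<rightarrow>\<^sub>M S" and Y: "Y \<in> M \<rightarrow>\<^sub>M T"
    using ind by (auto dest: indep_pair_measurable)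
  have "(\<lambda>\<omega>. f (X \<omega>)) -` A \<inter> space M = X -` (f -` A \<inter> space S) \<inter> space M" for A
    using measurable_space[OF X] by auto
  moreover have "(\<lambda>\<omega>. g (Y \<omega>)) -` B \<inter> space M = Y -` (g -` B \<inter> space T) \<inter> space M" for B
    using measurable_space[OF Y] by auto
  ultimately show ?thesis
    using ind measurable_compose[OF X f] measurable_compose[OF Y g]
      measurable_sets[OF f] measurable_sets[OF g]
    by (simp add: indep_pair_def del: vimage_Int)
qed

text \<open>\<open>indep_set\<close> requires both generated sigma-algebras to consist of events;
  measurability of the two path maps into the product spaces is read off from that.\<close>

lemma (in prob_space) indep_families_imp_indep_pair:
  assumes "indep_families M I X J Y"
  shows "indep_pair M (PiM I (\<lambda>_. borel)) (\<lambda>\<omega>. \<lambda>i\<in>I. X i \<omega>) (PiM J (\<lambda>_. borel)) (\<lambda>\<omega>. \<lambda>j\<in>J. Y j \<omega>)"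
proof -
  let ?X = "\<lambda>\<omega>. \<lambda>i\<in>I. X i \<omega>" and ?Y = "\<lambda>\<omega>. \<lambda>j\<in>J. Y j \<omega>"
  let ?A = "sets (vimage_algebra (space M) ?X (PiM I (\<lambda>_. borel)))"
  let ?B = "sets (vimage_algebra (space M) ?Y (PiM J (\<lambda>_. borel)))"
  have ind: "indep_set ?A ?B"
    using assms by (simp add: indep_families_def)
  have AB: "?A \<subseteq> events" "?B \<subseteq> events"
    using ind unfolding indep_set_def indep_sets_def by (auto split: bool.splits)
  have "random_variable (PiM I (\<lambda>_. borel)) ?X"
    using AB(1) by (intro measurableI) (auto simp: space_PiM intro!: subsetD[OF AB(1)] in_vimage_algebra)
  moreover have "random_variable (PiM J (\<lambda>_. borel)) ?Y"
    using AB(2) by (intro measurableI) (auto simp: space_PiM intro!: subsetD[OF AB(2)] in_vimage_algebra)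
  ultimately show ?thesis
    using indep_setD[OF ind] unfolding indep_pair_def by (auto intro!: in_vimage_algebra)
qed

text \<open>The joint law is the product of the marginal laws, so these are Tonelli and Fubini.
  Writing both marginals back as integrals over \<open>M\<close>, with \<open>\<omega>'\<close> as
  an independent copy of the sample point, makes the inner integral a conditional expectation given
  \<open>Y\<close>.\<close>

lemma (in prob_space)
  assumes ind: "indep_pair M S X T Y"
  shows indep_pair_nn_integral:
      "\<And>f. f \<in> borel_measurable (S \<Otimes>\<^sub>M T) \<Longrightarrow>
        (\<integral>\<^sup>+\<omega>. f (X \<omega>, Y \<omega>) \<partial>M) = (\<integral>\<^sup>+\<omega>. \<integral>\<^sup>+\<omega>'. f (X \<omega>', Y \<omega>) \<partial>M \<partial>M)"
    and indep_pair_integral: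
      "\<And>f :: _ \<Rightarrow> real. f \<in> borel_measurable (S \<Otimes>\<^sub>M T) \<Longrightarrow> integrable M (\<lambda>\<omega>. f (X \<omega>, Y \<omega>)) \<Longrightarrow>
        (\<integral>\<omega>. f (X \<omega>, Y \<omega>) \<partial>M) = (\<integral>\<omega>. \<integral>\<omega>'. f (X \<omega>', Y \<omega>) \<partial>M \<partial>M)"
proof -
  have [measurable]: "random_variable S X" "random_variable T Y"
    using ind by (auto dest: indep_pair_measurable)
  interpret X: prob_space "distr M S X" by (rule prob_space_distr) measurable
  interpret Y: prob_space "distr M T Y" by (rule prob_space_distr) measurable
  interpret XY: pair_prob_space "distr M S X" "distr M T Y" ..
  have eq: "distr M (S \<Otimes>\<^sub>M T) (\<lambda>\<omega>. (X \<omega>, Y \<omega>)) = distr M S X \<Otimes>\<^sub>M distr M T Y"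
  proof (rule pair_measure_eqI[symmetric])
    fix A B assume "A \<in> sets (distr M S X)" "B \<in> sets (distr M T Y)"
    then have A[measurable]: "A \<in> sets S" and B[measurable]: "B \<in> sets T"
      by auto
    have "(\<lambda>\<omega>. (X \<omega>, Y \<omega>)) -` (A \<times> B) \<inter> space M = (X -` A \<inter> space M) \<inter> (Y -` B \<inter> space M)"
      by auto
    then show "emeasure (distr M S X) A * emeasure (distr M T Y) B =
        emeasure (distr M (S \<Otimes>\<^sub>M T) (\<lambda>\<omega>. (X \<omega>, Y \<omega>))) (A \<times> B)"
      using ind A B by (simp add: emeasure_distr emeasure_eq_measure indep_pair_def ennreal_mult)
  qed (auto intro: X.sigma_finite_measure Y.sigma_finite_measure)
  {
    fix f :: "_ \<Rightarrow> ennreal" assume f[measurable]: "f \<in> borel_measurable (S \<Otimes>\<^sub>M T)"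
    have [measurable]: "f \<in> borel_measurable (distr M S X \<Otimes>\<^sub>M distr M T Y)"
      using f by simp
    have "(\<integral>\<^sup>+\<omega>. f (X \<omega>, Y \<omega>) \<partial>M) = (\<integral>\<^sup>+z. f z \<partial>(distr M S X \<Otimes>\<^sub>M distr M T Y))"
      by (simp add: eq[symmetric] nn_integral_distr)
    also have "\<dots> = (\<integral>\<^sup>+y. \<integral>\<^sup>+x. f (x, y) \<partial>distr M S X \<partial>distr M T Y)"
      by (rule XY.nn_integral_snd[symmetric]) measurable
    also have "\<dots> = (\<integral>\<^sup>+\<omega>. \<integral>\<^sup>+x. f (x, Y \<omega>) \<partial>distr M S X \<partial>M)"
      by (rule nn_integral_distr) simp_all
    also have "\<dots> = (\<integral>\<^sup>+\<omega>. \<integral>\<^sup>+\<omega>'. f (X \<omega>', Y \<omega>) \<partial>M \<partial>M)"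
      by (intro nn_integral_cong nn_integral_distr) (auto dest: measurable_space)
    finally show "(\<integral>\<^sup>+\<omega>. f (X \<omega>, Y \<omega>) \<partial>M) = (\<integral>\<^sup>+\<omega>. \<integral>\<^sup>+\<omega>'. f (X \<omega>', Y \<omega>) \<partial>M \<partial>M)" .
  }
  {
    fix f :: "_ \<Rightarrow> real" assume f[measurable]: "f \<in> borel_measurable (S \<Otimes>\<^sub>M T)"
      and int: "integrable M (\<lambda>\<omega>. f (X \<omega>, Y \<omega>))"
    have int': "integrable (distr M S X \<Otimes>\<^sub>M distr M T Y) (case_prod (curry f))"
      using int by (simp add: eq[symmetric] integrable_distr_eq)
    have "(\<integral>\<omega>. f (X \<omega>, Y \<omega>) \<partial>M) = (\<integral>z. f z \<partial>(distr M S X \<Otimes>\<^sub>M distr M T Y))"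
      by (simp add: eq[symmetric] integral_distr)
    also have "\<dots> = (\<integral>y. \<integral>x. f (x, y) \<partial>distr M S X \<partial>distr M T Y)"
      using XY.integral_snd[OF int'] by simp
    also have "\<dots> = (\<integral>\<omega>. \<integral>x. f (x, Y \<omega>) \<partial>distr M S X \<partial>M)"
      by (rule integral_distr) simp_all
    also have "\<dots> = (\<integral>\<omega>. \<integral>\<omega>'. f (X \<omega>', Y \<omega>) \<partial>M \<partial>M)"
      by (intro Bochner_Integration.integral_cong refl integral_distr) (auto dest: measurable_space)
    finally show "(\<integral>\<omega>. f (X \<omega>, Y \<omega>) \<partial>M) = (\<integral>\<omega>. \<integral>\<omega>'. f (X \<omega>', Y \<omega>) \<partial>M \<partial>M)" .
  }
qed

text \<open>Countability makes joint measurability a countable gluing of the sections. For an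
  uncountable index such as a real time the analogue fails, already for the evaluation of
  paths.\<close>

lemma countable_index_measurable:
  fixes f :: "'x \<Rightarrow> 'j::countable \<Rightarrow> real"
  assumes "\<And>j. (\<lambda>x. f x j) \<in> borel_measurable S"
  shows "(\<lambda>(x, j). f x j) \<in> borel_measurable (S \<Otimes>\<^sub>M count_space UNIV)"
  using measurable_compose_countable[of "\<lambda>j z. f (fst z) j" "S \<Otimes>\<^sub>M count_space UNIV" borel snd] assms
  by (simp add: split_beta' measurable_compose[OF measurable_fst])

lemma random_index_measurable:
  fixes J :: "'a \<Rightarrow> 'j::countable" and f :: "'x \<Rightarrow> 'j \<Rightarrow> real"
  assumes ind: "indep_pair M S X (count_space UNIV) J"
    and f: "\<And>j. (\<lambda>x. f x j) \<in> borel_measurable S"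
  shows "(\<lambda>\<omega>. f (X \<omega>) (J \<omega>)) \<in> borel_measurable M"
proof -
  have [measurable]: "X \<in> M \<rightarrow>\<^sub>M S" "J \<in> M \<rightarrow>\<^sub>M count_space UNIV"
    using ind by (auto dest: indep_pair_measurable)
  show ?thesis
    using measurable_compose[OF _ countable_index_measurable[of f S, OF f], of "\<lambda>\<omega>. (X \<omega>, J \<omega>)" M] by simp
qed

text \<open>For a frozen index the absolute mean is controlled by \<open>h\<close>, and Tonelli
  integrates this control over \<open>J\<close>. The bound is asked only almost surely because in
  the applications it rests on almost sure facts, such as the order of two random indices.\<close>

lemma (in prob_space) random_index_bound:
  fixes J :: "'a \<Rightarrow> 'j::countable" and f :: "'x \<Rightarrow> 'j \<Rightarrow> real"
  assumes ind: "indep_pair M S X (count_space UNIV) J"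
    and f: "\<And>j. (\<lambda>x. f x j) \<in> borel_measurable S"
    and int: "\<And>j. integrable M (\<lambda>\<omega>. f (X \<omega>) j)"
    and bound: "AE \<omega> in M. (\<integral>\<omega>'. \<bar>f (X \<omega>') (J \<omega>)\<bar> \<partial>M) \<le> h \<omega>"
    and h: "integrable M h"
  shows "integrable M (\<lambda>\<omega>. f (X \<omega>) (J \<omega>))"
    and "(\<integral>\<omega>. \<bar>f (X \<omega>) (J \<omega>)\<bar> \<partial>M) \<le> (\<integral>\<omega>. h \<omega> \<partial>M)"
proof -
  have [measurable]: "random_variable S X" "random_variable (count_space UNIV) J"
    using ind by (auto dest: indep_pair_measurable)
  note m[measurable] = countable_index_measurable[of f S, OF f]
  have h_nonneg: "AE \<omega> in M. 0 \<le> h \<omega>"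
    using bound by eventually_elim (rule order_trans[rotated], auto)
  have "(\<integral>\<^sup>+\<omega>. ennreal \<bar>f (X \<omega>) (J \<omega>)\<bar> \<partial>M) =
      (\<integral>\<^sup>+\<omega>. \<integral>\<^sup>+\<omega>'. ennreal \<bar>f (X \<omega>') (J \<omega>)\<bar> \<partial>M \<partial>M)"
    using indep_pair_nn_integral[OF ind, of "\<lambda>(x, j). ennreal \<bar>f x j\<bar>"] by simp
  also have "\<dots> = (\<integral>\<^sup>+\<omega>. ennreal (\<integral>\<omega>'. \<bar>f (X \<omega>') (J \<omega>)\<bar> \<partial>M) \<partial>M)"
    using int by (intro nn_integral_cong nn_integral_eq_integral) auto
  also have "\<dots> \<le> (\<integral>\<^sup>+\<omega>. ennreal (h \<omega>) \<partial>M)"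
    using bound by (intro nn_integral_mono_AE) (auto intro: ennreal_leI)
  also have "\<dots> = ennreal (\<integral>\<omega>. h \<omega> \<partial>M)"
    by (rule nn_integral_eq_integral[OF h h_nonneg])
  finally have le: "(\<integral>\<^sup>+\<omega>. ennreal \<bar>f (X \<omega>) (J \<omega>)\<bar> \<partial>M) \<le> ennreal (\<integral>\<omega>. h \<omega> \<partial>M)" .
  note [measurable] = random_index_measurable[of M S X J f, OF ind f]
  show int': "integrable M (\<lambda>\<omega>. f (X \<omega>) (J \<omega>))"
    using le by (intro integrableI_bounded) (auto simp: le_less_trans)
  show "(\<integral>\<omega>. \<bar>f (X \<omega>) (J \<omega>)\<bar> \<partial>M) \<le> (\<integral>\<omega>. h \<omega> \<partial>M)"
    using le integral_nonneg_AE[OF h_nonneg] by (simp add: nn_integral_eq_integral[OF integrable_abs[OF int']])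
qed

text \<open>A tower property with \<open>g\<close> as the conditional mean given \<open>J\<close>.
  Integrability is supplied separately, usually by \<open>random_index_bound\<close> with a cruder
  bound than \<open>g\<close>.\<close>

lemma (in prob_space) random_index_expectation:
  fixes J :: "'a \<Rightarrow> 'j::countable" and f :: "'x \<Rightarrow> 'j \<Rightarrow> real"
  assumes ind: "indep_pair M S X (count_space UNIV) J"
    and f: "\<And>j. (\<lambda>x. f x j) \<in> borel_measurable S"
    and int: "integrable M (\<lambda>\<omega>. f (X \<omega>) (J \<omega>))"
    and g[measurable]: "g \<in> borel_measurable M"
    and mean: "AE \<omega> in M. (\<integral>\<omega>'. f (X \<omega>') (J \<omega>) \<partial>M) = g \<omega>"
  shows "(\<integral>\<omega>. f (X \<omega>) (J \<omega>) \<partial>M) = (\<integral>\<omega>. g \<omega> \<partial>M)"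
proof -
  have [measurable]: "random_variable S X" "random_variable (count_space UNIV) J"
    using ind by (auto dest: indep_pair_measurable)
  note m[measurable] = countable_index_measurable[of f S, OF f]
  have "(\<integral>\<omega>. f (X \<omega>) (J \<omega>) \<partial>M) = (\<integral>\<omega>. \<integral>\<omega>'. f (X \<omega>') (J \<omega>) \<partial>M \<partial>M)"
    using indep_pair_integral[OF ind m] int by simp
  also have "\<dots> = (\<integral>\<omega>. g \<omega> \<partial>M)"
  proof (rule integral_cong_AE)
    \<comment> \<open>The inner mean is a function of \<open>J\<close> alone, and on a discrete
      index space every function is measurable.\<close>
    have eq: "(\<lambda>\<omega>. \<integral>\<omega>'. f (X \<omega>') (J \<omega>) \<partial>M) = (\<lambda>j. \<integral>\<omega>'. f (X \<omega>') j \<partial>M) \<circ> J"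
      by auto
    show *: "(\<lambda>\<omega>. \<integral>\<omega>'. f (X \<omega>') (J \<omega>) \<partial>M) \<in> borel_measurable M"
      unfolding eq by measurable
  qed (use mean in auto)
  finally show "(\<integral>\<omega>. f (X \<omega>) (J \<omega>) \<partial>M) = (\<integral>\<omega>. g \<omega> \<partial>M)" .
qed

section \<open>Moments of the Poisson process\<close>

text \<open>The Stein-Chen identity of the Poisson law, from (n + 1) p(n + 1) = \<open>\<mu>\<close>
  p(n). Taking \<open>f\<close> constant and then the identity yields the first two moments;
  extended nonnegative values make all series converge.\<close>

lemma nn_integral_poisson_shift:
  fixes f :: "nat \<Rightarrow> ennreal"
  assumes "0 < \<mu>"
  shows "(\<integral>\<^sup>+n. of_nat n * f n \<partial>poisson_pmf \<mu>) = ennreal \<mu> * (\<integral>\<^sup>+n. f (Suc n) \<partial>poisson_pmf \<mu>)"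
proof -
  let ?p = "\<lambda>n. ennreal (pmf (poisson_pmf \<mu>) n)"
  have step: "?p (Suc n) * (of_nat (Suc n) * f (Suc n)) = ennreal \<mu> * (?p n * f (Suc n))" for n
  proof -
    have "pmf (poisson_pmf \<mu>) (Suc n) * real (Suc n) = \<mu> * pmf (poisson_pmf \<mu>) n"
      using assms by (simp add: divide_simps del: of_nat_Suc)
    then have "?p (Suc n) * of_nat (Suc n) = ennreal \<mu> * ?p n"
      using assms by (metis ennreal_mult ennreal_of_nat_eq_real_of_nat less_imp_le of_nat_0_le_iff pmf_nonneg)
    then show ?thesis by (metis mult.assoc)
  qed
  have "(\<integral>\<^sup>+n. of_nat n * f n \<partial>poisson_pmf \<mu>) = (\<Sum>n. ?p n * (of_nat n * f n))"
    by (simp add: nn_integral_measure_pmf nn_integral_count_space_nat)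
  \<comment> \<open>The term at 0 vanishes because of the factor \<open>of_nat n\<close>.\<close>
  also have "\<dots> = (\<Sum>n. ?p (Suc n) * (of_nat (Suc n) * f (Suc n)))"
    using sums_Suc[OF summable_sums[OF summableI], of "\<lambda>n. ?p n * (of_nat n * f n)"]
    by (simp add: sums_iff)
  also have "\<dots> = ennreal \<mu> * (\<Sum>n. ?p n * f (Suc n))"
    by (simp only: step ennreal_suminf_cmult)
  also have "(\<Sum>n. ?p n * f (Suc n)) = (\<integral>\<^sup>+n. f (Suc n) \<partial>poisson_pmf \<mu>)"
    by (simp add: nn_integral_measure_pmf nn_integral_count_space_nat)
  finally show ?thesis .
qed

lemma has_bochner_integral_poisson:
  assumes "0 < \<mu>"
  shows "has_bochner_integral (poisson_pmf \<mu>) real \<mu>"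
    and "has_bochner_integral (poisson_pmf \<mu>) (\<lambda>n. (real n)\<^sup>2) (\<mu> + \<mu>\<^sup>2)"
proof -
  have 1: "(\<integral>\<^sup>+n. of_nat n \<partial>poisson_pmf \<mu>) = ennreal \<mu>"
    using nn_integral_poisson_shift[OF assms, of "\<lambda>_. 1"] by simp
  have "(\<integral>\<^sup>+n. ennreal ((real n)\<^sup>2) \<partial>poisson_pmf \<mu>) = (\<integral>\<^sup>+n. of_nat n * of_nat n \<partial>poisson_pmf \<mu>)"
    by (simp add: power2_eq_square ennreal_mult ennreal_of_nat_eq_real_of_nat)
  also have "\<dots> = ennreal \<mu> * (\<integral>\<^sup>+n. 1 + of_nat n \<partial>poisson_pmf \<mu>)"
    using nn_integral_poisson_shift[OF assms, of of_nat] by simp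
  also have "\<dots> = ennreal \<mu> * (1 + ennreal \<mu>)"
    by (subst nn_integral_add) (simp_all add: 1)
  also have "\<dots> = ennreal (\<mu> + \<mu>\<^sup>2)"
    using assms
    by (simp add: distrib_left ennreal_plus[symmetric] ennreal_mult[symmetric] power2_eq_square
        del: ennreal_plus)
  finally show "has_bochner_integral (poisson_pmf \<mu>) (\<lambda>n. (real n)\<^sup>2) (\<mu> + \<mu>\<^sup>2)"
    using assms by (intro has_bochner_integral_nn_integral) auto
  show "has_bochner_integral (poisson_pmf \<mu>) real \<mu>"
    using assms 1 by (intro has_bochner_integral_nn_integral) (auto simp: ennreal_of_nat_eq_real_of_nat)
qed

section \<open>Square-integrable variables and the two moment conditions\<close>

lemma square_integrable_measurable: "square_integrable M X \<Longrightarrow> X \<in> borel_measurable M"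
  by (simp add: square_integrable_def)

lemma square_integrable_mult:
  assumes X: "square_integrable M X" and Y: "square_integrable M Y"
  shows "integrable M (\<lambda>\<omega>. X \<omega> * Y \<omega>)"
proof (rule Bochner_Integration.integrable_bound)
  show "integrable M (\<lambda>\<omega>. (X \<omega>)\<^sup>2 + (Y \<omega>)\<^sup>2)"
    using X Y by (auto simp: square_integrable_def)
  show "(\<lambda>\<omega>. X \<omega> * Y \<omega>) \<in> borel_measurable M"
    using X Y by (auto simp: square_integrable_def)
  have "\<bar>x * y\<bar> \<le> x\<^sup>2 + y\<^sup>2" for x y :: real
    using sum_squares_bound[of "\<bar>x\<bar>" "\<bar>y\<bar>"] abs_ge_zero[of "x * y"]
    unfolding abs_mult power2_abs by linarith
  then show "AE \<omega> in M. norm (X \<omega> * Y \<omega>) \<le> norm ((X \<omega>)\<^sup>2 + (Y \<omega>)\<^sup>2)"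
    by simp
qed

lemma square_integrable_add:
  assumes X: "square_integrable M X" and Y: "square_integrable M Y"
  shows "square_integrable M (\<lambda>\<omega>. X \<omega> + Y \<omega>)"
  using X Y square_integrable_mult[OF X Y]
  by (auto simp add: square_integrable_def power2_sum mult.assoc)

lemma square_integrable_diff:
  assumes X: "square_integrable M X" and Y: "square_integrable M Y"
  shows "square_integrable M (\<lambda>\<omega>. X \<omega> - Y \<omega>)"
  using X Y square_integrable_mult[OF X Y]
  by (auto simp add: square_integrable_def power2_diff mult.assoc)

lemma (in finite_measure) square_integrable_integrable:
  "square_integrable M X \<Longrightarrow> integrable M X"
  unfolding square_integrable_def by (auto intro: square_integrable_imp_integrable)

text \<open>The second clause is the L1 modulus of continuity that replaces second moments in the
  passage to random times. \<open>C\<close> is kept apart from \<open>m\<close> because without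
  monotone paths the mean absolute increment can exceed the mean increment.\<close>

definition linear_mean :: "'a measure \<Rightarrow> (real \<Rightarrow> 'a \<Rightarrow> real) \<Rightarrow> real \<Rightarrow> real \<Rightarrow> bool" where
  "linear_mean M W m C \<longleftrightarrow>
     (\<forall>r\<ge>0. integrable M (W r) \<and> (\<integral>\<omega>. W r \<omega> \<partial>M) = m * r) \<and>
     (\<forall>r\<ge>0. \<forall>r'\<ge>r. (\<integral>\<omega>. \<bar>W r' \<omega> - W r \<omega>\<bar> \<partial>M) \<le> C * (r' - r))"

text \<open>The product moment is that of a process started at 0 with stationary independent
  increments, mean rate \<open>m\<close> and variance rate \<open>A\<close>; at
  \<open>r = r' = 1\<close> it reads \<open>A + m\<^sup>2\<close>.\<close>

definition linear_covariance :: "'a measure \<Rightarrow> (real \<Rightarrow> 'a \<Rightarrow> real) \<Rightarrow> real \<Rightarrow> real \<Rightarrow> bool" where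
  "linear_covariance M W m A \<longleftrightarrow>
     (\<forall>r\<ge>0. square_integrable M (W r)) \<and>
     (\<forall>r\<ge>0. \<forall>r'\<ge>r. (\<integral>\<omega>. W r \<omega> * W r' \<omega> \<partial>M) = A * r + m\<^sup>2 * r * r')"

section \<open>Increments of the Poisson process\<close>

context prob_space
begin

lemma poisson_process_measurable:
  assumes "poisson_process M \<nu> N" "0 \<le> r"
  shows "N r \<in> M \<rightarrow>\<^sub>M count_space UNIV"
proof -
  have "(\<lambda>\<omega>. real (N r \<omega>)) \<in> borel_measurable M"
    using assms by (simp add: poisson_process_def levy_process_def)
  then have "(\<lambda>\<omega>. nat \<lfloor>real (N r \<omega>)\<rfloor>) \<in> M \<rightarrow>\<^sub>M count_space UNIV"
    by measurable
  then show ?thesis by simp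
qed

text \<open>Only the one-dimensional laws are specified to be Poisson; stationarity carries them
  over to increments once the almost surely vanishing \<open>N 0\<close> is dropped. Strict
  \<open>r < r'\<close> keeps the rate positive.\<close>

lemma poisson_process_increment:
  assumes N: "poisson_process M \<nu> N" and "0 < \<nu>" "0 \<le> r" "r < r'"
  shows "distr M borel (\<lambda>\<omega>. real (N r' \<omega>) - real (N r \<omega>)) =
    distr (poisson_pmf (\<nu> * (r' - r))) borel real"
proof -
  note [measurable] = poisson_process_measurable[OF N]
  have 0: "AE \<omega> in M. real (N 0 \<omega>) = 0"
    and stat: "\<forall>s\<ge>0. \<forall>h\<ge>0. distr M borel (\<lambda>\<omega>. real (N (s + h) \<omega>) - real (N s \<omega>)) =
                    distr M borel (\<lambda>\<omega>. real (N h \<omega>) - real (N 0 \<omega>))"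
    and law: "\<forall>t>0. distr M (count_space UNIV) (N t) = measure_pmf (poisson_pmf (\<nu> * t))"
    using N by (simp_all add: poisson_process_def levy_process_def)
  have "distr M borel (\<lambda>\<omega>. real (N r' \<omega>) - real (N r \<omega>)) =
      distr M borel (\<lambda>\<omega>. real (N (r' - r) \<omega>) - real (N 0 \<omega>))"
    using stat[rule_format, of r "r' - r"] assms by simp
  also have "\<dots> = distr M borel (\<lambda>\<omega>. real (N (r' - r) \<omega>))"
    using 0 assms by (intro distr_cong_AE) auto
  also have "\<dots> = distr (distr M (count_space UNIV) (N (r' - r))) borel real"
    using assms by (subst distr_distr) (auto simp: comp_def)
  also have "\<dots> = distr (poisson_pmf (\<nu> * (r' - r))) borel real"
    using law assms by simp
  finally show ?thesis .
qed

text \<open>Monotone paths are not part of the definition. The law of an increment lives on the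
  natural numbers, hence each increment is almost surely nonnegative, with a null set that may
  depend on the two times.\<close>

lemma poisson_process_mono:
  assumes N: "poisson_process M \<nu> N" and "0 < \<nu>" "0 \<le> r" "r \<le> r'"
  shows "AE \<omega> in M. N r \<omega> \<le> N r' \<omega>"
proof (cases "r = r'")
  case False
  note [measurable] = poisson_process_measurable[OF N]
  have "AE x in distr M borel (\<lambda>\<omega>. real (N r' \<omega>) - real (N r \<omega>)). 0 \<le> x"
    using assms False by (subst poisson_process_increment[OF N]) (auto simp: AE_distr_iff)
  then have "AE \<omega> in M. 0 \<le> real (N r' \<omega>) - real (N r \<omega>)"
    using assms by (subst (asm) AE_distr_iff) auto
  then show ?thesis by eventually_elim simp
qed simp

lemma poisson_process_increment_moments:
  assumes N: "poisson_process M \<nu> N" and "0 < \<nu>" "0 \<le> r" "r \<le> r'"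
  shows "has_bochner_integral M (\<lambda>\<omega>. real (N r' \<omega>) - real (N r \<omega>)) (\<nu> * (r' - r))"
    and "has_bochner_integral M (\<lambda>\<omega>. (real (N r' \<omega>) - real (N r \<omega>))\<^sup>2)
      (\<nu> * (r' - r) + (\<nu> * (r' - r))\<^sup>2)"
proof -
  note [measurable] = poisson_process_measurable[OF N]
  let ?D = "\<lambda>\<omega>. real (N r' \<omega>) - real (N r \<omega>)"
  have "has_bochner_integral M ?D (\<nu> * (r' - r)) \<and>
      has_bochner_integral M (\<lambda>\<omega>. (?D \<omega>)\<^sup>2) (\<nu> * (r' - r) + (\<nu> * (r' - r))\<^sup>2)"
  proof (cases "r = r'")
    case False
    have D[measurable]: "?D \<in> borel_measurable M"
      using assms by auto
    have *: "distr M borel ?D = distr (poisson_pmf (\<nu> * (r' - r))) borel real"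
      using assms False by (intro poisson_process_increment) auto
    have "has_bochner_integral M (\<lambda>\<omega>. g (?D \<omega>)) x"
      if "has_bochner_integral (poisson_pmf (\<nu> * (r' - r))) (\<lambda>n. g (real n)) x"
        and [measurable]: "g \<in> borel_measurable borel" for g :: "real \<Rightarrow> real" and x
    proof -
      have "integrable (distr M borel ?D) g" "integral\<^sup>L (distr M borel ?D) g = x"
        using that(1) unfolding * by (auto simp: integrable_distr_eq integral_distr has_bochner_integral_iff)
      then show ?thesis
        by (simp add: integrable_distr_eq integral_distr has_bochner_integral_iff)
    qed
    note this[of "\<lambda>x. x"] this[of "\<lambda>x. x\<^sup>2"]
    then show ?thesis
      using has_bochner_integral_poisson[of "\<nu> * (r' - r)"] assms False by auto
  qed (simp add: has_bochner_integral_zero)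
  then show "has_bochner_integral M ?D (\<nu> * (r' - r))"
    "has_bochner_integral M (\<lambda>\<omega>. (?D \<omega>)\<^sup>2) (\<nu> * (r' - r) + (\<nu> * (r' - r))\<^sup>2)"
    by auto
qed

text \<open>The product moment comes from N(r) N(r') = N(r) (N(r') - N(r)) + N(r)^2: the two factors
  of the first term are independent, and the second is a Poisson second moment.\<close>

lemma
  assumes N: "poisson_process M \<nu> N" and "0 < \<nu>"
  shows poisson_process_linear_mean: "linear_mean M (\<lambda>r \<omega>. real (N r \<omega>)) \<nu> \<nu>"
    and poisson_process_linear_covariance: "linear_covariance M (\<lambda>r \<omega>. real (N r \<omega>)) \<nu> \<nu>"
proof -
  note [measurable] = poisson_process_measurable[OF N]
  have 0: "AE \<omega> in M. N 0 \<omega> = 0"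
    using N by (simp add: poisson_process_def levy_process_def)
  have 1: "has_bochner_integral M (\<lambda>\<omega>. real (N r \<omega>)) (\<nu> * r)" if "0 \<le> r" for r
    using poisson_process_increment_moments(1)[OF N assms(2) _ that] 0 that
    by (subst has_bochner_integral_cong_AE[where g="\<lambda>\<omega>. real (N r \<omega>) - real (N 0 \<omega>)"]) auto
  have 2: "has_bochner_integral M (\<lambda>\<omega>. (real (N r \<omega>))\<^sup>2) (\<nu> * r + (\<nu> * r)\<^sup>2)" if "0 \<le> r" for r
    using poisson_process_increment_moments(2)[OF N assms(2) _ that] 0 that
    by (subst has_bochner_integral_cong_AE[where g="\<lambda>\<omega>. (real (N r \<omega>) - real (N 0 \<omega>))\<^sup>2"]) auto
  show "linear_mean M (\<lambda>r \<omega>. real (N r \<omega>)) \<nu> \<nu>"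
    unfolding linear_mean_def
  proof (intro conjI allI impI)
    fix r r' :: real assume r: "0 \<le> r" "r \<le> r'"
    \<comment> \<open>By monotonicity the absolute value drops almost surely, so the increment bound
      holds with equality and with \<open>\<nu>\<close> itself as constant.\<close>
    have "(\<integral>\<omega>. \<bar>real (N r' \<omega>) - real (N r \<omega>)\<bar> \<partial>M) = (\<integral>\<omega>. real (N r' \<omega>) - real (N r \<omega>) \<partial>M)"
      using poisson_process_mono[OF assms r] r by (intro integral_cong_AE) auto
    also have "\<dots> = \<nu> * (r' - r)"
      using poisson_process_increment_moments(1)[OF assms r] by (simp add: has_bochner_integral_iff)
    finally show "(\<integral>\<omega>. \<bar>real (N r' \<omega>) - real (N r \<omega>)\<bar> \<partial>M) \<le> \<nu> * (r' - r)"
      by simp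
  qed (use 1 in \<open>auto simp: has_bochner_integral_iff\<close>)
  show "linear_covariance M (\<lambda>r \<omega>. real (N r \<omega>)) \<nu> \<nu>"
    unfolding linear_covariance_def
  proof (intro conjI allI impI)
    fix r :: real assume "0 \<le> r"
    then show "square_integrable M (\<lambda>\<omega>. real (N r \<omega>))"
      using 2[of r] by (auto simp: square_integrable_def has_bochner_integral_iff)
  next
    fix r r' :: real assume r: "0 \<le> r" "r \<le> r'"
    \<comment> \<open>\<open>levy_process\<close> speaks of infinite nondecreasing sequences of
      times; 0, r, r', r', ... has the two relevant increments as its first two.\<close>
    define \<tau> where "\<tau> i = (if i = 0 then 0 else if i = 1 then r else r')" for i :: nat
    have "0 \<le> \<tau> 0 \<and> mono \<tau>"
      using r by (auto simp: \<tau>_def mono_def)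
    then have "indep_vars (\<lambda>_. borel) (\<lambda>i \<omega>. real (N (\<tau> (Suc i)) \<omega>) - real (N (\<tau> i) \<omega>)) {..<2}"
      using N unfolding poisson_process_def levy_process_def by blast
    note ind = this
    have int: "integrable M (\<lambda>\<omega>. real (N (\<tau> (Suc i)) \<omega>) - real (N (\<tau> i) \<omega>))" if "i \<in> {..<2}" for i
      using that poisson_process_increment_moments(1)[OF assms _ r(1)]
        poisson_process_increment_moments(1)[OF assms r]
      by (auto simp: \<tau>_def has_bochner_integral_iff less_2_cases_iff)
    have "has_bochner_integral M (\<lambda>\<omega>. (real (N r \<omega>) - real (N 0 \<omega>)) * (real (N r' \<omega>) - real (N r \<omega>)))
        (\<nu> * r * (\<nu> * (r' - r)))"
      using indep_vars_lebesgue_integral[OF _ ind int] indep_vars_integrable[OF _ ind int]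
      using poisson_process_increment_moments(1)[OF assms _ r(1)]
        poisson_process_increment_moments(1)[OF assms r]
      by (simp add: has_bochner_integral_iff \<tau>_def numeral_2_eq_2)
    from has_bochner_integral_add[OF this 2[OF r(1)]]
    have "has_bochner_integral M (\<lambda>\<omega>. real (N r \<omega>) * real (N r' \<omega>))
        (\<nu> * r * (\<nu> * (r' - r)) + (\<nu> * r + (\<nu> * r)\<^sup>2))"
      \<comment> \<open>The independent increment is \<open>N r - N 0\<close>; it may be replaced by
        \<open>N r\<close> off the null set where \<open>N 0\<close> differs from 0.\<close>
      using 0 r
      by (subst has_bochner_integral_cong_AE[where g="\<lambda>\<omega>. (real (N r \<omega>) - real (N 0 \<omega>)) *
          (real (N r' \<omega>) - real (N r \<omega>)) + (real (N r \<omega>))\<^sup>2"])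
        (auto simp: power2_eq_square algebra_simps)
    then show "(\<integral>\<omega>. real (N r \<omega>) * real (N r' \<omega>) \<partial>M) = \<nu> * r + \<nu>\<^sup>2 * r * r'"
      by (simp add: has_bochner_integral_iff power2_eq_square algebra_simps)
  qed
qed

end

section \<open>Random sums\<close>

lemma borel_measurable_sum_components:
  assumes "A \<subseteq> I"
  shows "(\<lambda>x. \<Sum>i\<in>A. x i :: real) \<in> borel_measurable (PiM I (\<lambda>_. borel))"
  using assms by (intro borel_measurable_sum[where f="\<lambda>i x. x i"] measurable_component_singleton) auto

context prob_space
begin

context
  fixes Y :: "nat \<Rightarrow> 'a \<Rightarrow> real" and N :: "real \<Rightarrow> 'a \<Rightarrow> nat" and m \<nu> C' :: real
  assumes ind: "\<And>r r'. 0 \<le> r \<Longrightarrow> 0 \<le> r' \<Longrightarrow>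
      indep_pair M (PiM {1..} (\<lambda>_. borel)) (\<lambda>\<omega>. \<lambda>i\<in>{1..}. Y i \<omega>) (count_space UNIV) (\<lambda>\<omega>. (N r \<omega>, N r' \<omega>))"
    and N_mono: "\<And>r r'. 0 \<le> r \<Longrightarrow> r \<le> r' \<Longrightarrow> AE \<omega> in M. N r \<omega> \<le> N r' \<omega>"
    and N_mean: "linear_mean M (\<lambda>r \<omega>. real (N r \<omega>)) \<nu> C'"
    and Y_int: "\<And>i. 1 \<le> i \<Longrightarrow> integrable M (Y i)"
    and Y_mean: "\<And>i. 1 \<le> i \<Longrightarrow> (\<integral>\<omega>. Y i \<omega> \<partial>M) = m"
begin

text \<open>Given the indices, a block of summands has mean \<open>m\<close> and absolute mean at
  most \<open>C\<close> per term. Averaging over \<open>N\<close> multiplies both by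
  \<open>\<nu>\<close>, because the mean number of terms between the two times is
  \<open>\<nu> * (r' - r)\<close>.\<close>

lemma random_sum_linear_mean:
  assumes Y_abs: "\<And>i. 1 \<le> i \<Longrightarrow> (\<integral>\<omega>. \<bar>Y i \<omega>\<bar> \<partial>M) = C"
  shows "linear_mean M (\<lambda>r \<omega>. \<Sum>i=1..N r \<omega>. Y i \<omega>) (m * \<nu>) (C * \<nu>)"
proof -
  let ?R = "\<lambda>\<omega>. \<lambda>i\<in>{1..}. Y i \<omega>"
  have N_int: "integrable M (\<lambda>\<omega>. real (N r \<omega>))" "(\<integral>\<omega>. real (N r \<omega>) \<partial>M) = \<nu> * r" if "0 \<le> r" for r
    using N_mean that by (auto simp: linear_mean_def)
  have sum_meas[measurable]: "(\<lambda>x. \<Sum>i=1..a. x i :: real) \<in> borel_measurable (PiM {1..} (\<lambda>_. borel))" for a :: nat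
    by (rule borel_measurable_sum_components) auto
  have abs_sum: "(\<integral>\<omega>. \<bar>\<Sum>i\<in>A. Y i \<omega>\<bar> \<partial>M) \<le> C * real (card A)" if "A \<subseteq> {1..}" for A
  proof -
    have "(\<integral>\<omega>. \<bar>\<Sum>i\<in>A. Y i \<omega>\<bar> \<partial>M) \<le> (\<integral>\<omega>. (\<Sum>i\<in>A. \<bar>Y i \<omega>\<bar>) \<partial>M)"
      using Y_int that by (intro integral_mono) (auto intro!: Bochner_Integration.integrable_sum integrable_abs)
    also have "\<dots> = (\<Sum>i\<in>A. \<integral>\<omega>. \<bar>Y i \<omega>\<bar> \<partial>M)"
      using Y_int that by (intro Bochner_Integration.integral_sum) auto
    also have "\<dots> = (\<Sum>i\<in>A. C)"
      using Y_abs that by (intro sum.cong) auto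
    finally show ?thesis by (simp add: mult.commute)
  qed
  have sum_int: "integrable M (\<lambda>\<omega>. \<Sum>i=1..a. Y i \<omega>)" for a
    using Y_int by (intro Bochner_Integration.integrable_sum) auto
  have single: "integrable M (\<lambda>\<omega>. \<Sum>i=1..N r \<omega>. Y i \<omega>) \<and> (\<integral>\<omega>. (\<Sum>i=1..N r \<omega>. Y i \<omega>) \<partial>M) = m * \<nu> * r"
    if r: "0 \<le> r" for r
  proof -
    \<comment> \<open>The independence assumption concerns a pair of times, so a single time enters
      as the pair \<open>(r, r)\<close>, of which \<open>?f\<close> reads the first entry.\<close>
    let ?f = "\<lambda>x (j :: nat \<times> nat). (\<Sum>i=1..fst j. x i :: real)"
    have mean: "AE \<omega> in M. (\<integral>\<omega>'. ?f (?R \<omega>') (N r \<omega>, N r \<omega>) \<partial>M) = m * real (N r \<omega>)"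
      using Y_int Y_mean by (intro AE_I2) (simp add: Bochner_Integration.integral_sum)
    have bound: "AE \<omega> in M. (\<integral>\<omega>'. \<bar>?f (?R \<omega>') (N r \<omega>, N r \<omega>)\<bar> \<partial>M) \<le> C * real (N r \<omega>)"
      using abs_sum[of "{1..N r _}"] by (intro AE_I2) auto
    have N: "integrable M (\<lambda>\<omega>. c * real (N r \<omega>))" for c
      using N_int[OF r] by simp
    have R: "?f (?R \<omega>) j = (\<Sum>i=1..fst j. Y i \<omega>)" for \<omega> j
      by simp
    have f_int: "integrable M (\<lambda>\<omega>. ?f (?R \<omega>) j)" for j
      unfolding R by (rule sum_int)
    note int = random_index_bound(1)[OF ind[OF r r], of ?f, OF sum_meas f_int bound N]
    note int random_index_expectation[OF ind[OF r r], of ?f,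
        OF sum_meas int borel_measurable_integrable[OF N] mean]
    then show ?thesis
      using N_int[OF r] by simp
  qed
  moreover have "(\<integral>\<omega>. \<bar>(\<Sum>i=1..N r' \<omega>. Y i \<omega>) - (\<Sum>i=1..N r \<omega>. Y i \<omega>)\<bar> \<partial>M) \<le> C * \<nu> * (r' - r)"
    if r: "0 \<le> r" "r \<le> r'" for r r'
  proof -
    \<comment> \<open>This block sum equals the difference of the two partial sums where
      \<open>N r \<omega> \<le> N r' \<omega>\<close>, hence almost surely, and its number of terms
      is the increment of \<open>N\<close>.\<close>
    let ?f = "\<lambda>x j. (\<Sum>i\<in>{fst j<..snd j}. x i :: real)"
    have r': "0 \<le> r'" using r by simp
    have "{a<..b} \<subseteq> {1..}" for a b :: nat by auto
    note abs_sum' = abs_sum[OF this]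
    have int: "integrable M (\<lambda>\<omega>. \<Sum>i\<in>{a<..b}. Y i \<omega>)" for a b
      using Y_int by (intro Bochner_Integration.integrable_sum) auto
    have meas: "(\<lambda>x. \<Sum>i\<in>{a<..b}. x i :: real) \<in> borel_measurable (PiM {1..} (\<lambda>_. borel))" for a b :: nat
      by (rule borel_measurable_sum_components) auto
    have R: "?f (?R \<omega>) j = (\<Sum>i\<in>{fst j<..snd j}. Y i \<omega>)" for \<omega> j
      by (intro sum.cong) auto
    have bound: "AE \<omega> in M. (\<integral>\<omega>'. \<bar>?f (?R \<omega>') (N r \<omega>, N r' \<omega>)\<bar> \<partial>M) \<le> C * (real (N r' \<omega>) - real (N r \<omega>))"
      using N_mono[OF r]
    proof eventually_elim
      case (elim \<omega>)
      then show ?case using abs_sum'[of "N r \<omega>" "N r' \<omega>"] unfolding R by (simp add: of_nat_diff)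
    qed
    have N: "integrable M (\<lambda>\<omega>. c * (real (N r' \<omega>) - real (N r \<omega>)))"
        "(\<integral>\<omega>. c * (real (N r' \<omega>) - real (N r \<omega>)) \<partial>M) = c * \<nu> * (r' - r)" for c
      using N_int[OF r(1)] N_int[OF r'] by (auto simp: algebra_simps)
    have int': "integrable M (\<lambda>\<omega>. ?f (?R \<omega>) j)" for j
      unfolding R by (rule int)
    note * = random_index_bound[OF ind[OF r(1) r'], of ?f, OF meas int' bound N(1)]
    have "(\<integral>\<omega>. \<bar>(\<Sum>i=1..N r' \<omega>. Y i \<omega>) - (\<Sum>i=1..N r \<omega>. Y i \<omega>)\<bar> \<partial>M) =
        (\<integral>\<omega>. \<bar>?f (?R \<omega>) (N r \<omega>, N r' \<omega>)\<bar> \<partial>M)"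
    proof (rule integral_cong_AE)
      show "AE \<omega> in M. \<bar>(\<Sum>i=1..N r' \<omega>. Y i \<omega>) - (\<Sum>i=1..N r \<omega>. Y i \<omega>)\<bar> =
          \<bar>?f (?R \<omega>) (N r \<omega>, N r' \<omega>)\<bar>"
        using N_mono[OF r]
      proof eventually_elim
        case (elim \<omega>)
        have "{1..N r' \<omega>} - {1..N r \<omega>} = {N r \<omega><..N r' \<omega>}" by auto
        then show ?case unfolding R using elim by (subst sum_diff[symmetric]) auto
      qed
    qed (use * single[OF r(1)] single[OF r'] in auto)
    also have "\<dots> \<le> C * \<nu> * (r' - r)"
      using *(2) unfolding N(2) .
    finally show ?thesis .
  qed
  ultimately show ?thesis
    by (simp add: linear_mean_def)
qed

text \<open>For frozen indices a and b with a at most b, the product of the partial sums has mean v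
  a + m^2 a b, where \<open>v\<close> is the variance of one summand. Averaging with the moments of
  \<open>N\<close> gives the new variance rate \<open>v * \<nu> + m\<^sup>2 * \<rho>\<close>, an
  instance of the law of total variance.\<close>

lemma random_sum_linear_covariance:
  assumes N_cov: "linear_covariance M (\<lambda>r \<omega>. real (N r \<omega>)) \<nu> \<rho>"
    and Y_sq: "\<And>i. 1 \<le> i \<Longrightarrow> square_integrable M (Y i)"
    and Y_cov: "\<And>i j. 1 \<le> i \<Longrightarrow> 1 \<le> j \<Longrightarrow> (\<integral>\<omega>. Y i \<omega> * Y j \<omega> \<partial>M) = m\<^sup>2 + (if i = j then v else 0)"
    and W_meas: "\<And>r. 0 \<le> r \<Longrightarrow> (\<lambda>\<omega>. \<Sum>i=1..N r \<omega>. Y i \<omega>) \<in> borel_measurable M"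
  shows "linear_covariance M (\<lambda>r \<omega>. \<Sum>i=1..N r \<omega>. Y i \<omega>) (m * \<nu>) (v * \<nu> + m\<^sup>2 * \<rho>)"
proof -
  let ?R = "\<lambda>\<omega>. \<lambda>i\<in>{1..}. Y i \<omega>"
  let ?f = "\<lambda>x j. (\<Sum>i=1..fst j. x i) * (\<Sum>i=1..snd j. x i :: real)"
  have N_int: "integrable M (\<lambda>\<omega>. real (N r \<omega>))" "(\<integral>\<omega>. real (N r \<omega>) \<partial>M) = \<nu> * r" if "0 \<le> r" for r
    using N_mean that by (auto simp: linear_mean_def)
  have N_prod: "integrable M (\<lambda>\<omega>. real (N r \<omega>) * real (N r' \<omega>))"
      "(\<integral>\<omega>. real (N r \<omega>) * real (N r' \<omega>) \<partial>M) = \<rho> * r + \<nu>\<^sup>2 * r * r'"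
    if "0 \<le> r" "r \<le> r'" for r r'
    using N_cov that by (auto simp: linear_covariance_def intro!: square_integrable_mult)
  have [measurable]: "(\<lambda>x. \<Sum>i=1..a. x i :: real) \<in> borel_measurable (PiM {1..} (\<lambda>_. borel))" for a :: nat
    by (rule borel_measurable_sum_components) auto
  have f_meas: "(\<lambda>x. ?f x j) \<in> borel_measurable (PiM {1..} (\<lambda>_. borel))" for j
    by measurable
  have Y_prod: "integrable M (\<lambda>\<omega>. Y i \<omega> * Y j \<omega>)" if "1 \<le> i" "1 \<le> j" for i j
    using Y_sq that by (auto intro!: square_integrable_mult)
  have prod: "?f (?R \<omega>) (a, b) = (\<Sum>i=1..a. \<Sum>j=1..b. Y i \<omega> * Y j \<omega>)" for a b \<omega>
    by (simp add: sum_product)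
  have f_int: "integrable M (\<lambda>\<omega>. ?f (?R \<omega>) j)" for j
    unfolding prod[of _ "fst j" "snd j", unfolded prod.collapse] using Y_prod
    by (intro Bochner_Integration.integrable_sum) auto
  have f_mean: "(\<integral>\<omega>. ?f (?R \<omega>) (a, b) \<partial>M) = v * real a + m\<^sup>2 * (real a * real b)" if "a \<le> b" for a b
  proof -
    have "(\<integral>\<omega>. ?f (?R \<omega>) (a, b) \<partial>M) = (\<Sum>i=1..a. \<Sum>j=1..b. \<integral>\<omega>. Y i \<omega> * Y j \<omega> \<partial>M)"
      unfolding prod using Y_prod
      by (subst Bochner_Integration.integral_sum)
        (auto intro!: Bochner_Integration.integrable_sum sum.cong Bochner_Integration.integral_sum)
    also have "\<dots> = (\<Sum>i=1..a. \<Sum>j=1..b. m\<^sup>2 + (if i = j then v else 0))"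
      using Y_cov by (intro sum.cong) auto
    \<comment> \<open>Since \<open>a \<le> b\<close>, the diagonal index \<open>j = i\<close> occurs
      exactly once in each inner sum.\<close>
    also have "\<dots> = (\<Sum>i=1..a. real b * m\<^sup>2 + v)"
      using that by (intro sum.cong) (auto simp: sum.distrib)
    finally show ?thesis by (simp add: algebra_simps)
  qed
  \<comment> \<open>This cruder bound serves only for integrability. Each term is at most the mean
    of two squares, and every square has expectation \<open>m\<^sup>2 + v\<close>.\<close>
  have f_abs: "(\<integral>\<omega>. \<bar>?f (?R \<omega>) (a, b)\<bar> \<partial>M) \<le> (m\<^sup>2 + v) * (real a * real b)" for a b
  proof -
    have YY: "(\<integral>\<omega>. \<bar>Y i \<omega> * Y j \<omega>\<bar> \<partial>M) \<le> m\<^sup>2 + v" if "1 \<le> i" "1 \<le> j" for i j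
    proof -
      have *: "\<bar>x * y\<bar> \<le> (x * x + y * y) / 2" for x y :: real
        using sum_squares_bound[of "\<bar>x\<bar>" "\<bar>y\<bar>"] by (simp add: abs_mult power2_eq_square)
      have "(\<integral>\<omega>. \<bar>Y i \<omega> * Y j \<omega>\<bar> \<partial>M) \<le> (\<integral>\<omega>. (Y i \<omega> * Y i \<omega> + Y j \<omega> * Y j \<omega>) / 2 \<partial>M)"
        using Y_prod that * by (intro integral_mono) auto
      also have "\<dots> = m\<^sup>2 + v"
        using Y_prod that Y_cov by simp
      finally show ?thesis .
    qed
    have "(\<integral>\<omega>. \<bar>?f (?R \<omega>) (a, b)\<bar> \<partial>M) \<le> (\<integral>\<omega>. (\<Sum>i=1..a. \<Sum>j=1..b. \<bar>Y i \<omega> * Y j \<omega>\<bar>) \<partial>M)"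
      unfolding prod using Y_prod
      by (intro integral_mono)
        (auto intro!: Bochner_Integration.integrable_sum order_trans[OF sum_abs] sum_mono)
    also have "\<dots> = (\<Sum>i=1..a. \<Sum>j=1..b. \<integral>\<omega>. \<bar>Y i \<omega> * Y j \<omega>\<bar> \<partial>M)"
      using Y_prod by (subst Bochner_Integration.integral_sum)
        (auto intro!: Bochner_Integration.integrable_sum sum.cong Bochner_Integration.integral_sum)
    also have "\<dots> \<le> (\<Sum>i=1..a. \<Sum>j=1..b. m\<^sup>2 + v)"
      using YY by (intro sum_mono) auto
    finally show ?thesis by (simp add: algebra_simps)
  qed
  have main: "integrable M (\<lambda>\<omega>. (\<Sum>i=1..N r \<omega>. Y i \<omega>) * (\<Sum>i=1..N r' \<omega>. Y i \<omega>))"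
    "(\<integral>\<omega>. (\<Sum>i=1..N r \<omega>. Y i \<omega>) * (\<Sum>i=1..N r' \<omega>. Y i \<omega>) \<partial>M) =
       (v * \<nu> + m\<^sup>2 * \<rho>) * r + (m * \<nu>)\<^sup>2 * r * r'"
    if r: "0 \<le> r" "r \<le> r'" for r r'
  proof -
    have r': "0 \<le> r'" using r by simp
    have mean: "AE \<omega> in M. (\<integral>\<omega>'. ?f (?R \<omega>') (N r \<omega>, N r' \<omega>) \<partial>M) =
        v * real (N r \<omega>) + m\<^sup>2 * (real (N r \<omega>) * real (N r' \<omega>))"
      using N_mono[OF r] by eventually_elim (rule f_mean)
    have bound: "AE \<omega> in M. (\<integral>\<omega>'. \<bar>?f (?R \<omega>') (N r \<omega>, N r' \<omega>)\<bar> \<partial>M) \<le>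
        (m\<^sup>2 + v) * (real (N r \<omega>) * real (N r' \<omega>))"
      by (intro AE_I2 f_abs)
    have g: "integrable M (\<lambda>\<omega>. v * real (N r \<omega>) + m\<^sup>2 * (real (N r \<omega>) * real (N r' \<omega>)))"
      using N_prod[OF r] N_int[OF r(1)] by auto
    have h: "integrable M (\<lambda>\<omega>. (m\<^sup>2 + v) * (real (N r \<omega>) * real (N r' \<omega>)))"
      using N_prod[OF r] by auto
    note int = random_index_bound(1)[OF ind[OF r(1) r'], of ?f, OF f_meas f_int bound h]
    note int random_index_expectation[OF ind[OF r(1) r'], of ?f,
        OF f_meas int borel_measurable_integrable[OF g] mean]
    then show "integrable M (\<lambda>\<omega>. (\<Sum>i=1..N r \<omega>. Y i \<omega>) * (\<Sum>i=1..N r' \<omega>. Y i \<omega>))"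
      "(\<integral>\<omega>. (\<Sum>i=1..N r \<omega>. Y i \<omega>) * (\<Sum>i=1..N r' \<omega>. Y i \<omega>) \<partial>M) =
         (v * \<nu> + m\<^sup>2 * \<rho>) * r + (m * \<nu>)\<^sup>2 * r * r'"
      using N_prod[OF r] N_int[OF r(1)] by (simp_all add: algebra_simps power2_eq_square)
  qed
  show ?thesis
    unfolding linear_covariance_def square_integrable_def
    using main(1)[OF _ order_refl] main(2) W_meas by (auto simp: power2_eq_square)
qed

end

end

section \<open>Convergence in mean square\<close>

text \<open>Fatou's lemma. It will turn an estimate between the grids \<open>n\<close> and
  \<open>k\<close>, uniform over \<open>k\<close> beyond \<open>n\<close>, into an estimate between
  grid \<open>n\<close> and the limit.\<close>

lemma nn_integral_le_of_AE_tendsto: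
  fixes w :: "nat \<Rightarrow> 'a \<Rightarrow> ennreal"
  assumes meas: "\<And>k. w k \<in> borel_measurable M"
    and lim: "AE \<omega> in M. (\<lambda>k. w k \<omega>) \<longlonglongrightarrow> v \<omega>"
    and le: "eventually (\<lambda>k. (\<integral>\<^sup>+\<omega>. w k \<omega> \<partial>M) \<le> B) sequentially"
  shows "(\<integral>\<^sup>+\<omega>. v \<omega> \<partial>M) \<le> B"
proof -
  have "(\<integral>\<^sup>+\<omega>. v \<omega> \<partial>M) = (\<integral>\<^sup>+\<omega>. liminf (\<lambda>k. w k \<omega>) \<partial>M)"
    using lim by (intro nn_integral_cong_AE) (auto elim!: eventually_mono simp: lim_imp_Liminf)
  also have "\<dots> \<le> liminf (\<lambda>k. \<integral>\<^sup>+\<omega>. w k \<omega> \<partial>M)"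
    by (rule nn_integral_liminf) (rule meas)
  also have "\<dots> \<le> B"
    using le by (intro Liminf_le) auto
  finally show ?thesis .
qed

lemma integral_abs_mult_le_sqrt:
  assumes X: "square_integrable M X" and Y: "square_integrable M Y"
  shows "\<bar>\<integral>\<omega>. X \<omega> * Y \<omega> \<partial>M\<bar> \<le> sqrt (\<integral>\<omega>. (X \<omega>)\<^sup>2 \<partial>M) * sqrt (\<integral>\<omega>. (Y \<omega>)\<^sup>2 \<partial>M)"
proof -
  have [measurable]: "X \<in> borel_measurable M" "Y \<in> borel_measurable M"
    and int: "integrable M (\<lambda>\<omega>. (X \<omega>)\<^sup>2)" "integrable M (\<lambda>\<omega>. (Y \<omega>)\<^sup>2)"
    using X Y by (auto simp: square_integrable_def)
  have XY: "integrable M (\<lambda>\<omega>. \<bar>X \<omega> * Y \<omega>\<bar>)"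
    using square_integrable_mult[OF X Y] by simp
  have "ennreal ((\<integral>\<omega>. \<bar>X \<omega> * Y \<omega>\<bar> \<partial>M)\<^sup>2) = (\<integral>\<^sup>+\<omega>. ennreal \<bar>X \<omega>\<bar> * ennreal \<bar>Y \<omega>\<bar> \<partial>M)\<^sup>2"
    using nn_integral_eq_integral[OF XY]
    by (simp add: abs_mult ennreal_mult ennreal_power)
  also have "\<dots> \<le> (\<integral>\<^sup>+\<omega>. (ennreal \<bar>X \<omega>\<bar>)\<^sup>2 \<partial>M) * (\<integral>\<^sup>+\<omega>. (ennreal \<bar>Y \<omega>\<bar>)\<^sup>2 \<partial>M)"
    by (rule Cauchy_Schwarz_nn_integral) auto
  also have "\<dots> = ennreal ((\<integral>\<omega>. (X \<omega>)\<^sup>2 \<partial>M) * (\<integral>\<omega>. (Y \<omega>)\<^sup>2 \<partial>M))"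
    using int by (simp add: ennreal_power ennreal_mult nn_integral_eq_integral)
  finally have "(\<integral>\<omega>. \<bar>X \<omega> * Y \<omega>\<bar> \<partial>M)\<^sup>2 \<le> (\<integral>\<omega>. (X \<omega>)\<^sup>2 \<partial>M) * (\<integral>\<omega>. (Y \<omega>)\<^sup>2 \<partial>M)"
    by (subst (asm) ennreal_le_iff) (auto intro!: mult_nonneg_nonneg)
  then have "(\<integral>\<omega>. \<bar>X \<omega> * Y \<omega>\<bar> \<partial>M) \<le> sqrt (\<integral>\<omega>. (X \<omega>)\<^sup>2 \<partial>M) * sqrt (\<integral>\<omega>. (Y \<omega>)\<^sup>2 \<partial>M)"
    unfolding real_sqrt_mult[symmetric] by (rule real_le_rsqrt)
  with integral_abs_bound[of M "\<lambda>\<omega>. X \<omega> * Y \<omega>"] show ?thesis by linarith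
qed

text \<open>The distance is measured by a nonnegative extended integral since the integrability of
  \<open>U\<close> is part of the conclusion: \<open>U\<close> is the square-integrable
  \<open>u 0\<close> minus a square-integrable error.\<close>

lemma L2_limit:
  fixes u :: "nat \<Rightarrow> 'a \<Rightarrow> real"
  assumes u: "\<And>n. square_integrable M (u n)" and U[measurable]: "U \<in> borel_measurable M"
    and le: "\<And>n. (\<integral>\<^sup>+\<omega>. ennreal ((u n \<omega> - U \<omega>)\<^sup>2) \<partial>M) \<le> ennreal (a n)"
    and a_nonneg: "\<And>n. 0 \<le> a n"
  shows "square_integrable M U" "\<And>n. square_integrable M (\<lambda>\<omega>. u n \<omega> - U \<omega>)"
    "\<And>n. (\<integral>\<omega>. (u n \<omega> - U \<omega>)\<^sup>2 \<partial>M) \<le> a n"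
proof -
  have [measurable]: "u n \<in> borel_measurable M" for n
    using u by (rule square_integrable_measurable)
  show *: "square_integrable M (\<lambda>\<omega>. u n \<omega> - U \<omega>)" for n
    unfolding square_integrable_def using le[of n]
    by (auto intro!: integrableI_bounded simp: le_less_trans)
  show "square_integrable M U"
    using square_integrable_diff[OF u[of 0] *[of 0]] by simp
  show "(\<integral>\<omega>. (u n \<omega> - U \<omega>)\<^sup>2 \<partial>M) \<le> a n" for n
    using le[of n] *[of n] a_nonneg[of n]
    by (subst (asm) nn_integral_eq_integral) (auto simp: square_integrable_def)
qed

text \<open>Continuity of the L2 inner product: with x = u - U and y = v - V one has u v - U V = x y
  + x V + U y, and Cauchy-Schwarz bounds each term.\<close>

lemma L2_limit_product:
  fixes u v :: "nat \<Rightarrow> 'a \<Rightarrow> real"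
  assumes u: "\<And>n. square_integrable M (u n)" and U: "U \<in> borel_measurable M"
    and u_le: "\<And>n. (\<integral>\<^sup>+\<omega>. ennreal ((u n \<omega> - U \<omega>)\<^sup>2) \<partial>M) \<le> ennreal (a n)"
    and a_nonneg: "\<And>n. 0 \<le> a n" and a: "a \<longlonglongrightarrow> 0"
    and v: "\<And>n. square_integrable M (v n)" and V: "V \<in> borel_measurable M"
    and v_le: "\<And>n. (\<integral>\<^sup>+\<omega>. ennreal ((v n \<omega> - V \<omega>)\<^sup>2) \<partial>M) \<le> ennreal (a n)"
  shows "(\<lambda>n. \<integral>\<omega>. u n \<omega> * v n \<omega> \<partial>M) \<longlonglongrightarrow> (\<integral>\<omega>. U \<omega> * V \<omega> \<partial>M)"
proof -
  note U' = L2_limit[OF u U u_le a_nonneg] and V' = L2_limit[OF v V v_le a_nonneg]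
  let ?x = "\<lambda>n \<omega>. u n \<omega> - U \<omega>" and ?y = "\<lambda>n \<omega>. v n \<omega> - V \<omega>"
  let ?c = "sqrt (\<integral>\<omega>. (U \<omega>)\<^sup>2 \<partial>M)" and ?d = "sqrt (\<integral>\<omega>. (V \<omega>)\<^sup>2 \<partial>M)"
  let ?e = "\<lambda>n. sqrt (a n) * sqrt (a n) + sqrt (a n) * ?d + ?c * sqrt (a n)"
  have le: "norm ((\<integral>\<omega>. u n \<omega> * v n \<omega> \<partial>M) - (\<integral>\<omega>. U \<omega> * V \<omega> \<partial>M)) \<le> ?e n" for n
  proof -
    have int: "integrable M (\<lambda>\<omega>. ?x n \<omega> * ?y n \<omega>)" "integrable M (\<lambda>\<omega>. ?x n \<omega> * V \<omega>)"
      "integrable M (\<lambda>\<omega>. U \<omega> * ?y n \<omega>)" "integrable M (\<lambda>\<omega>. U \<omega> * V \<omega>)"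
      by (intro square_integrable_mult U' V')+
    have "(\<integral>\<omega>. u n \<omega> * v n \<omega> \<partial>M) =
        (\<integral>\<omega>. ((?x n \<omega> * ?y n \<omega> + ?x n \<omega> * V \<omega>) + U \<omega> * ?y n \<omega>) + U \<omega> * V \<omega> \<partial>M)"
      by (intro Bochner_Integration.integral_cong) (auto simp: algebra_simps)
    also have "\<dots> = (\<integral>\<omega>. ?x n \<omega> * ?y n \<omega> \<partial>M) + (\<integral>\<omega>. ?x n \<omega> * V \<omega> \<partial>M) +
        (\<integral>\<omega>. U \<omega> * ?y n \<omega> \<partial>M) + (\<integral>\<omega>. U \<omega> * V \<omega> \<partial>M)"
      by (intro Bochner_Integration.integral_add[THEN trans] Bochner_Integration.integrable_add int
          arg_cong2[where f="(+)"] refl Bochner_Integration.integral_add)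
    finally have eq: "(\<integral>\<omega>. u n \<omega> * v n \<omega> \<partial>M) - (\<integral>\<omega>. U \<omega> * V \<omega> \<partial>M) =
        (\<integral>\<omega>. ?x n \<omega> * ?y n \<omega> \<partial>M) + (\<integral>\<omega>. ?x n \<omega> * V \<omega> \<partial>M) + (\<integral>\<omega>. U \<omega> * ?y n \<omega> \<partial>M)"
      by simp
    have x: "sqrt (\<integral>\<omega>. (?x n \<omega>)\<^sup>2 \<partial>M) \<le> sqrt (a n)" and y: "sqrt (\<integral>\<omega>. (?y n \<omega>)\<^sup>2 \<partial>M) \<le> sqrt (a n)"
      by (intro real_sqrt_le_mono U' V')+
    have "\<bar>\<integral>\<omega>. ?x n \<omega> * ?y n \<omega> \<partial>M\<bar> \<le> sqrt (a n) * sqrt (a n)"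
      by (rule order_trans[OF integral_abs_mult_le_sqrt mult_mono[OF x y]]) (intro U' V' real_sqrt_ge_zero a_nonneg Bochner_Integration.integral_nonneg zero_le_power2)+
    moreover have "\<bar>\<integral>\<omega>. ?x n \<omega> * V \<omega> \<partial>M\<bar> \<le> sqrt (a n) * ?d"
      by (rule order_trans[OF integral_abs_mult_le_sqrt mult_mono[OF x order_refl]]) (intro U' V' real_sqrt_ge_zero a_nonneg Bochner_Integration.integral_nonneg zero_le_power2)+
    moreover have "\<bar>\<integral>\<omega>. U \<omega> * ?y n \<omega> \<partial>M\<bar> \<le> ?c * sqrt (a n)"
      by (rule order_trans[OF integral_abs_mult_le_sqrt mult_mono[OF order_refl y]]) (intro U' V' real_sqrt_ge_zero a_nonneg Bochner_Integration.integral_nonneg zero_le_power2)+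
    ultimately show ?thesis
      unfolding eq real_norm_def by linarith
  qed
  have lim: "?e \<longlonglongrightarrow> 0"
    using a by (auto intro!: tendsto_eq_intros)
  show ?thesis
    by (rule LIM_zero_cancel, rule Lim_null_comparison[OF always_eventually lim]) (intro allI le)
qed

section \<open>Approximating times from the right by grid points\<close>

definition grid_index :: "nat \<Rightarrow> real \<Rightarrow> nat" where
  "grid_index n x = Suc (nat \<lfloor>real (Suc n) * x\<rfloor>)"

text \<open>The grid point strictly to the right of \<open>x\<close>, so that right limits can be taken along it.\<close>

definition grid_time :: "nat \<Rightarrow> real \<Rightarrow> real" where
  "grid_time n x = real (grid_index n x) / real (Suc n)"

lemma grid_index_measurable[measurable]: "grid_index n \<in> borel \<rightarrow>\<^sub>M count_space UNIV"
  unfolding grid_index_def[abs_def] by measurable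

lemma grid_time_measurable[measurable]: "grid_time n \<in> borel_measurable borel"
  unfolding grid_time_def[abs_def] by measurable

lemma grid_time_mono: "x \<le> y \<Longrightarrow> grid_time n x \<le> grid_time n y"
  unfolding grid_time_def grid_index_def
  by (intro divide_right_mono) (auto intro!: nat_mono floor_mono mult_left_mono)

lemma grid_time_nonneg: "0 \<le> grid_time n x"
  by (simp add: grid_time_def)

lemma grid_time_bounds:
  assumes "0 \<le> x"
  shows "x < grid_time n x" "grid_time n x \<le> x + 1 / real (Suc n)"
proof -
  have "0 \<le> \<lfloor>real (Suc n) * x\<rfloor>"
    using assms by simp
  then have eq: "real (grid_index n x) = of_int \<lfloor>real (Suc n) * x\<rfloor> + 1"
    by (simp add: grid_index_def del: of_nat_Suc zero_le_floor)
  have "x * real (Suc n) < real (grid_index n x)" "real (grid_index n x) \<le> x * real (Suc n) + 1"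
    unfolding eq mult.commute[of x] by linarith+
  then show "x < grid_time n x" "grid_time n x \<le> x + 1 / real (Suc n)"
    unfolding grid_time_def
    by (simp_all add: pos_less_divide_eq pos_divide_le_eq distrib_right del: of_nat_Suc)
qed

text \<open>The grids need not be nested; both points lie between \<open>x\<close> and
  \<open>x + 1 / real (Suc n)\<close>, since the mesh shrinks.\<close>

lemma grid_time_dist:
  assumes "0 \<le> x" "n \<le> k"
  shows "\<bar>grid_time n x - grid_time k x\<bar> \<le> 1 / real (Suc n)"
proof -
  have "1 / real (Suc k) \<le> 1 / real (Suc n)"
    using assms by (simp add: field_simps)
  then show ?thesis
    using grid_time_bounds[OF assms(1), of n] grid_time_bounds[OF assms(1), of k] by linarith
qed

lemma grid_time_tendsto:
  assumes "0 \<le> x"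
  shows "filterlim (\<lambda>n. grid_time n x) (at_right x) sequentially"
  unfolding filterlim_at
proof
  have "(\<lambda>n. x + 1 / real (Suc n)) \<longlonglongrightarrow> x + 0"
    by (intro tendsto_add tendsto_const LIMSEQ_Suc lim_1_over_n)
  then show "(\<lambda>n. grid_time n x) \<longlonglongrightarrow> x"
    using grid_time_bounds[OF assms]
    by (intro tendsto_sandwich[of "\<lambda>_. x" "\<lambda>n. grid_time n x" sequentially "\<lambda>n. x + 1 / real (Suc n)"])
      (auto intro!: always_eventually less_imp_le)
  show "\<forall>\<^sub>F n in sequentially. grid_time n x \<in> {x<..} \<and> grid_time n x \<noteq> x"
    using grid_time_bounds(1)[OF assms] by (auto simp: less_imp_neq[symmetric])
qed

section \<open>Time change at independent random times\<close>

lemma real_eqI_of_le_inverse_Suc: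
  fixes x y c :: real
  assumes "\<And>n. \<bar>x - y\<bar> \<le> c / real (Suc n)"
  shows "x = y"
proof -
  have "(\<lambda>n. c / real (Suc n)) \<longlonglongrightarrow> 0"
    by (rule LIMSEQ_Suc[OF lim_const_over_n])
  then have "\<bar>x - y\<bar> \<le> 0"
    using assms by (intro LIMSEQ_le_const) auto
  then show ?thesis by simp
qed

lemma measurable_Pair_count_space:
  fixes f :: "'a \<Rightarrow> 'b::countable" and g :: "'a \<Rightarrow> 'c::countable"
  assumes "f \<in> M \<rightarrow>\<^sub>M count_space UNIV" "g \<in> M \<rightarrow>\<^sub>M count_space UNIV"
  shows "(\<lambda>x. (f x, g x)) \<in> M \<rightarrow>\<^sub>M count_space UNIV"
  using measurable_Pair[OF assms] by (simp add: pair_measure_countable)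

lemma linear_mean_abs_diff:
  assumes "linear_mean M W m C" "0 \<le> r" "0 \<le> r'"
  shows "(\<integral>\<omega>. \<bar>W r \<omega> - W r' \<omega>\<bar> \<partial>M) \<le> C * \<bar>r - r'\<bar>"
  using assms unfolding linear_mean_def
  by (cases "r \<le> r'") (auto simp: abs_minus_commute)

lemma linear_covariance_product:
  assumes "linear_covariance M W m A" "0 \<le> r" "0 \<le> r'"
  shows "integrable M (\<lambda>\<omega>. W r \<omega> * W r' \<omega>)" "(\<integral>\<omega>. W r \<omega> * W r' \<omega> \<partial>M) = A * min r r' + m\<^sup>2 * r * r'"
proof -
  show "integrable M (\<lambda>\<omega>. W r \<omega> * W r' \<omega>)"
    using assms unfolding linear_covariance_def by (intro square_integrable_mult) auto
  show "(\<integral>\<omega>. W r \<omega> * W r' \<omega> \<partial>M) = A * min r r' + m\<^sup>2 * r * r'"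
    using assms unfolding linear_covariance_def
    by (cases "r \<le> r'") (auto simp: min_def mult.commute mult.left_commute)
qed

text \<open>Expanding the square leaves r + r' - 2 min(r, r') = |r - r'| as factor of
  \<open>A\<close>. This is the L2 modulus of continuity of the process.\<close>

lemma linear_covariance_diff:
  assumes "linear_covariance M W m A" "0 \<le> r" "0 \<le> r'"
  shows "integrable M (\<lambda>\<omega>. (W r \<omega> - W r' \<omega>)\<^sup>2)"
    "(\<integral>\<omega>. (W r \<omega> - W r' \<omega>)\<^sup>2 \<partial>M) = A * \<bar>r - r'\<bar> + m\<^sup>2 * (r - r')\<^sup>2"
proof -
  note P = linear_covariance_product[OF assms(1)]
  have eq: "(W r \<omega> - W r' \<omega>)\<^sup>2 = W r \<omega> * W r \<omega> + W r' \<omega> * W r' \<omega> - 2 * (W r \<omega> * W r' \<omega>)" for \<omega>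
    by (simp add: power2_eq_square algebra_simps)
  show "integrable M (\<lambda>\<omega>. (W r \<omega> - W r' \<omega>)\<^sup>2)"
    unfolding eq using P(1) assms by simp
  have "(\<integral>\<omega>. (W r \<omega> - W r' \<omega>)\<^sup>2 \<partial>M) = A * (r + r' - 2 * min r r') + m\<^sup>2 * (r - r')\<^sup>2"
    unfolding eq using P assms by (simp add: power2_eq_square algebra_simps)
  also have "r + r' - 2 * min r r' = \<bar>r - r'\<bar>"
    by auto
  finally show "(\<integral>\<omega>. (W r \<omega> - W r' \<omega>)\<^sup>2 \<partial>M) = A * \<bar>r - r'\<bar> + m\<^sup>2 * (r - r')\<^sup>2" .
qed

context prob_space
begin

lemma grid_time_integrable:
  assumes T: "integrable M T" "AE \<omega> in M. 0 \<le> T \<omega>"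
  shows "integrable M (\<lambda>\<omega>. grid_time n (T \<omega>))"
    "\<bar>(\<integral>\<omega>. grid_time n (T \<omega>) \<partial>M) - (\<integral>\<omega>. T \<omega> \<partial>M)\<bar> \<le> 1 / real (Suc n)"
proof -
  have [measurable]: "T \<in> borel_measurable M"
    using T by auto
  have bounds: "AE \<omega> in M. T \<omega> \<le> grid_time n (T \<omega>) \<and> grid_time n (T \<omega>) \<le> T \<omega> + 1 / real (Suc n)"
    using T(2) by eventually_elim (auto simp: grid_time_bounds less_imp_le simp del: of_nat_Suc)
  have h: "integrable M (\<lambda>\<omega>. T \<omega> + 1 / real (Suc n))"
    using T(1) by auto
  show int: "integrable M (\<lambda>\<omega>. grid_time n (T \<omega>))"
  proof (rule Bochner_Integration.integrable_bound[OF h])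
    show "AE \<omega> in M. norm (grid_time n (T \<omega>)) \<le> norm (T \<omega> + 1 / real (Suc n))"
      using bounds
    proof eventually_elim
      case (elim \<omega>)
      with grid_time_nonneg[of n "T \<omega>"] show ?case
        unfolding real_norm_def by linarith
    qed
  qed measurable
  have "(\<integral>\<omega>. T \<omega> \<partial>M) \<le> (\<integral>\<omega>. grid_time n (T \<omega>) \<partial>M)"
    using bounds T(1) int by (intro integral_mono_AE) auto
  moreover have "(\<integral>\<omega>. grid_time n (T \<omega>) \<partial>M) \<le> (\<integral>\<omega>. T \<omega> + 1 / real (Suc n) \<partial>M)"
    using bounds h int by (intro integral_mono_AE) auto
  moreover have "(\<integral>\<omega>. T \<omega> + 1 / real (Suc n) \<partial>M) = (\<integral>\<omega>. T \<omega> \<partial>M) + 1 / real (Suc n)"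
    using T(1) by (simp add: prob_space)
  ultimately show "\<bar>(\<integral>\<omega>. grid_time n (T \<omega>) \<partial>M) - (\<integral>\<omega>. T \<omega> \<partial>M)\<bar> \<le> 1 / real (Suc n)"
    by linarith
qed

lemma grid_time_square_integrable:
  assumes T: "square_integrable M T" "AE \<omega> in M. 0 \<le> T \<omega>"
  shows "square_integrable M (\<lambda>\<omega>. grid_time n (T \<omega>))"
    "(\<integral>\<^sup>+\<omega>. ennreal ((grid_time n (T \<omega>) - T \<omega>)\<^sup>2) \<partial>M) \<le> ennreal ((1 / real (Suc n))\<^sup>2)"
proof -
  have [measurable]: "T \<in> borel_measurable M"
    using T by (auto simp: square_integrable_def)
  have "AE \<omega> in M. (grid_time n (T \<omega>) - T \<omega>)\<^sup>2 \<le> (1 / real (Suc n))\<^sup>2"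
    using T(2)
  proof eventually_elim
    case (elim \<omega>)
    show ?case
      using grid_time_bounds[OF elim, of n] by (intro power_mono) linarith+
  qed
  then have "(\<integral>\<^sup>+\<omega>. ennreal ((grid_time n (T \<omega>) - T \<omega>)\<^sup>2) \<partial>M) \<le> (\<integral>\<^sup>+\<omega>. ennreal ((1 / real (Suc n))\<^sup>2) \<partial>M)"
    by (intro nn_integral_mono_AE) (auto elim!: eventually_mono intro: ennreal_leI)
  then show le: "(\<integral>\<^sup>+\<omega>. ennreal ((grid_time n (T \<omega>) - T \<omega>)\<^sup>2) \<partial>M) \<le> ennreal ((1 / real (Suc n))\<^sup>2)"
    by (simp add: emeasure_space_1)
  have "square_integrable M (\<lambda>\<omega>. grid_time n (T \<omega>) - T \<omega>)"
    unfolding square_integrable_def using le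
    by (auto intro!: integrableI_bounded simp: le_less_trans)
  from square_integrable_add[OF this T(1)] show "square_integrable M (\<lambda>\<omega>. grid_time n (T \<omega>))"
    by simp
qed

section \<open>Sampling at one random time\<close>

context
  fixes W :: "real \<Rightarrow> 'a \<Rightarrow> real" and T :: "'a \<Rightarrow> real"
  assumes ind: "indep_pair M (PiM {0..} (\<lambda>_. borel)) (\<lambda>\<omega>. \<lambda>r\<in>{0..}. W r \<omega>) borel T"
    and rc: "AE \<omega> in M. \<forall>t\<ge>0. ((\<lambda>r. W r \<omega>) \<longlongrightarrow> W t \<omega>) (at_right t)"
    and T_nonneg: "AE \<omega> in M. 0 \<le> T \<omega>"
    and WT[measurable]: "(\<lambda>\<omega>. W (T \<omega>) \<omega>) \<in> borel_measurable M"
begin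

private abbreviation R :: "'a \<Rightarrow> real \<Rightarrow> real" where "R \<equiv> \<lambda>\<omega>. \<lambda>r\<in>{0..}. W r \<omega>"

private lemma T_meas[measurable]: "T \<in> borel_measurable M"
  using ind by (auto dest: indep_pair_measurable)

private lemma component_meas: "(\<lambda>x. x (real j / real (Suc n)) :: real) \<in> borel_measurable (PiM {0..} (\<lambda>_. borel))"
  by (rule measurable_component_singleton) simp

private lemma grid_indep:
  "indep_pair M (PiM {0..} (\<lambda>_. borel)) R (count_space UNIV) (\<lambda>\<omega>. grid_index n (T \<omega>))"
  using indep_pair_compose[OF ind measurable_ident grid_index_measurable] by simp

private lemma grid_indep2:
  "indep_pair M (PiM {0..} (\<lambda>_. borel)) R (count_space UNIV) (\<lambda>\<omega>. (grid_index n (T \<omega>), grid_index k (T \<omega>)))"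
  using indep_pair_compose[OF ind measurable_ident measurable_Pair_count_space[OF grid_index_measurable grid_index_measurable]]
  by simp

private lemma R_grid: "R \<omega> (real (grid_index n (T \<omega>')) / real (Suc n)) = W (grid_time n (T \<omega>')) \<omega>"
  by (simp add: grid_time_def)

private lemma R_nat: "R \<omega> (real j / real (Suc n)) = W (real j / real (Suc n)) \<omega>"
  by simp

lemma grid_sample_measurable: "(\<lambda>\<omega>. W (grid_time n (T \<omega>)) \<omega>) \<in> borel_measurable M"
  using random_index_measurable[OF grid_indep[of n], of "\<lambda>x j. x (real j / real (Suc n))", OF component_meas]
  unfolding R_grid .

lemma grid_sample_tendsto:
  "AE \<omega> in M. (\<lambda>n. W (grid_time n (T \<omega>)) \<omega>) \<longlonglongrightarrow> W (T \<omega>) \<omega>"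
  using rc T_nonneg by eventually_elim (rule filterlim_compose[OF _ grid_time_tendsto], auto)

lemma time_change_mean:
  assumes lm: "linear_mean M W m C" and T: "integrable M T"
  shows "integrable M (\<lambda>\<omega>. W (T \<omega>) \<omega>)" "(\<integral>\<omega>. W (T \<omega>) \<omega> \<partial>M) = m * (\<integral>\<omega>. T \<omega> \<partial>M)"
proof -
  note [measurable] = grid_sample_measurable
  have W_int: "integrable M (W r)" and W_mean: "(\<integral>\<omega>. W r \<omega> \<partial>M) = m * r" if "0 \<le> r" for r
    using lm that by (auto simp: linear_mean_def)
  have grid: "integrable M (\<lambda>\<omega>. W (grid_time n (T \<omega>)) \<omega>)"
    "(\<integral>\<omega>. W (grid_time n (T \<omega>)) \<omega> \<partial>M) = m * (\<integral>\<omega>. grid_time n (T \<omega>) \<partial>M)" for n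
  proof -
    let ?f = "\<lambda>x j. x (real j / real (Suc n)) :: real"
    have f_int: "integrable M (\<lambda>\<omega>. ?f (R \<omega>) j)" for j
      unfolding R_nat using W_int by simp
    \<comment> \<open>The increment from time 0 bounds the absolute moment by an affine function of
      \<open>r\<close>, which stays integrable at the grid times; the value at 0 contributes only a
      finite constant.\<close>
    have "(\<integral>\<omega>. \<bar>W r \<omega>\<bar> \<partial>M) \<le> C * r + (\<integral>\<omega>. \<bar>W 0 \<omega>\<bar> \<partial>M)" if r: "0 \<le> r" for r
    proof -
      have "(\<integral>\<omega>. \<bar>W r \<omega>\<bar> \<partial>M) \<le> (\<integral>\<omega>. \<bar>W r \<omega> - W 0 \<omega>\<bar> + \<bar>W 0 \<omega>\<bar> \<partial>M)"
        using W_int r by (intro integral_mono) auto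
      also have "\<dots> = (\<integral>\<omega>. \<bar>W r \<omega> - W 0 \<omega>\<bar> \<partial>M) + (\<integral>\<omega>. \<bar>W 0 \<omega>\<bar> \<partial>M)"
        using W_int r by (intro Bochner_Integration.integral_add) auto
      finally show ?thesis
        using linear_mean_abs_diff[OF lm r order_refl] r by simp
    qed
    then have bound: "AE \<omega> in M. (\<integral>\<omega>'. \<bar>?f (R \<omega>') (grid_index n (T \<omega>))\<bar> \<partial>M) \<le>
        C * grid_time n (T \<omega>) + (\<integral>\<omega>. \<bar>W 0 \<omega>\<bar> \<partial>M)"
      unfolding R_grid by (intro AE_I2) (simp add: grid_time_nonneg)
    have h: "integrable M (\<lambda>\<omega>. C * grid_time n (T \<omega>) + (\<integral>\<omega>. \<bar>W 0 \<omega>\<bar> \<partial>M))"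
      using grid_time_integrable(1)[OF T T_nonneg] by simp
    have mean: "AE \<omega> in M. (\<integral>\<omega>'. ?f (R \<omega>') (grid_index n (T \<omega>)) \<partial>M) = m * grid_time n (T \<omega>)"
      unfolding R_grid by (intro AE_I2) (simp add: grid_time_nonneg W_mean)
    note int = random_index_bound(1)[OF grid_indep[of n], of ?f, OF component_meas f_int bound h]
    then show "integrable M (\<lambda>\<omega>. W (grid_time n (T \<omega>)) \<omega>)"
      unfolding R_grid .
    have "(\<lambda>\<omega>. m * grid_time n (T \<omega>)) \<in> borel_measurable M"
      by simp
    from random_index_expectation[OF grid_indep[of n], of ?f, OF component_meas int this mean]
    show "(\<integral>\<omega>. W (grid_time n (T \<omega>)) \<omega> \<partial>M) = m * (\<integral>\<omega>. grid_time n (T \<omega>) \<partial>M)"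
      unfolding R_grid by simp
  qed
  \<comment> \<open>Conditioning on both grid indices at once turns the increment bound of
    \<open>W\<close> into a Cauchy estimate. The absolute value of \<open>C\<close> appears because
    the sign of \<open>C\<close> is not prescribed by \<open>linear_mean\<close>.\<close>
  have cauchy: "(\<integral>\<^sup>+\<omega>. ennreal \<bar>W (grid_time n (T \<omega>)) \<omega> - W (grid_time k (T \<omega>)) \<omega>\<bar> \<partial>M) \<le> ennreal (\<bar>C\<bar> / real (Suc n))"
    if "n \<le> k" for n k
  proof -
    let ?f = "\<lambda>x j. x (real (fst j) / real (Suc n)) - x (real (snd j) / real (Suc k)) :: real"
    have f_meas: "(\<lambda>x. ?f x j) \<in> borel_measurable (PiM {0..} (\<lambda>_. borel))" for j
      by (intro borel_measurable_diff component_meas)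
    have f_int: "integrable M (\<lambda>\<omega>. ?f (R \<omega>) j)" for j
      unfolding R_nat using W_int by simp
    have bound: "AE \<omega> in M. (\<integral>\<omega>'. \<bar>?f (R \<omega>') (grid_index n (T \<omega>), grid_index k (T \<omega>))\<bar> \<partial>M) \<le> \<bar>C\<bar> / real (Suc n)"
      using T_nonneg
    proof eventually_elim
      case (elim \<omega>)
      have "(\<integral>\<omega>'. \<bar>W (grid_time n (T \<omega>)) \<omega>' - W (grid_time k (T \<omega>)) \<omega>'\<bar> \<partial>M) \<le>
          C * \<bar>grid_time n (T \<omega>) - grid_time k (T \<omega>)\<bar>"
        by (rule linear_mean_abs_diff[OF lm grid_time_nonneg grid_time_nonneg])
      also have "\<dots> \<le> \<bar>C\<bar> * (1 / real (Suc n))"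
        using grid_time_dist[OF elim that] by (intro mult_mono) auto
      finally show ?case
        unfolding fst_conv snd_conv R_grid by simp
    qed
    have h: "integrable M (\<lambda>\<omega>. \<bar>C\<bar> / real (Suc n))"
      by simp
    note * = random_index_bound[OF grid_indep2[of n k], of ?f, OF f_meas f_int bound h,
        unfolded fst_conv snd_conv R_grid]
    show ?thesis
      using *(2) by (subst nn_integral_eq_integral[OF integrable_abs[OF *(1)]]) (auto simp: prob_space intro: ennreal_leI)
  qed
  \<comment> \<open>Here \<open>n\<close> is fixed while \<open>k\<close> tends to infinity.\<close>
  have le: "(\<integral>\<^sup>+\<omega>. ennreal \<bar>W (grid_time n (T \<omega>)) \<omega> - W (T \<omega>) \<omega>\<bar> \<partial>M) \<le> ennreal (\<bar>C\<bar> / real (Suc n))" for n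
  proof (rule nn_integral_le_of_AE_tendsto)
    show "AE \<omega> in M. (\<lambda>k. ennreal \<bar>W (grid_time n (T \<omega>)) \<omega> - W (grid_time k (T \<omega>)) \<omega>\<bar>) \<longlonglongrightarrow>
        ennreal \<bar>W (grid_time n (T \<omega>)) \<omega> - W (T \<omega>) \<omega>\<bar>"
      using grid_sample_tendsto by eventually_elim (intro tendsto_intros)
    show "\<forall>\<^sub>F k in sequentially. (\<integral>\<^sup>+\<omega>. ennreal \<bar>W (grid_time n (T \<omega>)) \<omega> - W (grid_time k (T \<omega>)) \<omega>\<bar> \<partial>M) \<le>
        ennreal (\<bar>C\<bar> / real (Suc n))"
      using cauchy by (auto simp: eventually_sequentially simp del: of_nat_Suc)
  qed measurable
  have diff_int: "integrable M (\<lambda>\<omega>. W (grid_time n (T \<omega>)) \<omega> - W (T \<omega>) \<omega>)" for n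
    using le[of n] by (intro integrableI_bounded) (auto simp: le_less_trans)
  show int: "integrable M (\<lambda>\<omega>. W (T \<omega>) \<omega>)"
    using Bochner_Integration.integrable_diff[OF grid(1)[of 0] diff_int[of 0]] by simp
  show "(\<integral>\<omega>. W (T \<omega>) \<omega> \<partial>M) = m * (\<integral>\<omega>. T \<omega> \<partial>M)"
  \<comment> \<open>Two errors of order 1/(n + 1) add up: replacing the sample at \<open>T\<close>
    by the grid sample costs \<open>\<bar>C\<bar>\<close>, replacing the mean of the grid time by
    that of \<open>T\<close> costs \<open>\<bar>m\<bar>\<close>.\<close>
  proof (rule real_eqI_of_le_inverse_Suc[where c="\<bar>C\<bar> + \<bar>m\<bar>"])
    fix n
    have "\<bar>m * (\<integral>\<omega>. grid_time n (T \<omega>) \<partial>M) - (\<integral>\<omega>. W (T \<omega>) \<omega> \<partial>M)\<bar> \<le>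
        (\<integral>\<omega>. \<bar>W (grid_time n (T \<omega>)) \<omega> - W (T \<omega>) \<omega>\<bar> \<partial>M)"
      unfolding grid(2)[symmetric] Bochner_Integration.integral_diff[OF grid(1) int, symmetric]
      by (rule integral_abs_bound)
    also have "\<dots> \<le> \<bar>C\<bar> / real (Suc n)"
      using le[of n] by (simp add: nn_integral_eq_integral[OF integrable_abs[OF diff_int]])
    moreover have "\<bar>m * (\<integral>\<omega>. grid_time n (T \<omega>) \<partial>M) - m * (\<integral>\<omega>. T \<omega> \<partial>M)\<bar> \<le> \<bar>m\<bar> / real (Suc n)"
      using mult_left_mono[OF grid_time_integrable(2)[OF T T_nonneg, of n], of "\<bar>m\<bar>"]
      by (simp add: abs_mult[symmetric] right_diff_distrib)
    ultimately show "\<bar>(\<integral>\<omega>. W (T \<omega>) \<omega> \<partial>M) - m * (\<integral>\<omega>. T \<omega> \<partial>M)\<bar> \<le> (\<bar>C\<bar> + \<bar>m\<bar>) / real (Suc n)"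
      by (simp add: add_divide_distrib)
  qed
qed

text \<open>The bound is the L2 modulus of continuity evaluated at the mesh 1/(n + 1), which
  dominates the distance between the times of any two grids from \<open>n\<close> on.\<close>

lemma grid_sample_L2:
  assumes lc: "linear_covariance M W m A" and T: "square_integrable M T"
  shows "square_integrable M (\<lambda>\<omega>. W (grid_time n (T \<omega>)) \<omega>)"
    "(\<integral>\<^sup>+\<omega>. ennreal ((W (grid_time n (T \<omega>)) \<omega> - W (T \<omega>) \<omega>)\<^sup>2) \<partial>M) \<le>
       ennreal (\<bar>A\<bar> / real (Suc n) + m\<^sup>2 * (1 / real (Suc n))\<^sup>2)"
proof -
  note [measurable] = grid_sample_measurable
  note P = linear_covariance_product[OF lc]
  show "square_integrable M (\<lambda>\<omega>. W (grid_time n (T \<omega>)) \<omega>)"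
    unfolding square_integrable_def
  proof
    let ?f = "\<lambda>x j. (x (real j / real (Suc n)) :: real)\<^sup>2"
    have f_meas: "(\<lambda>x. ?f x j) \<in> borel_measurable (PiM {0..} (\<lambda>_. borel))" for j
      by (intro borel_measurable_power component_meas)
    have f_int: "integrable M (\<lambda>\<omega>. ?f (R \<omega>) j)" for j
      unfolding R_nat using P(1) by (simp add: power2_eq_square)
    \<comment> \<open>The second moment of \<open>W\<close> at a fixed time is quadratic in that
      time, so square integrability of the grid time is exactly what is needed.\<close>
    have bound: "AE \<omega> in M. (\<integral>\<omega>'. \<bar>?f (R \<omega>') (grid_index n (T \<omega>))\<bar> \<partial>M) \<le>
        A * grid_time n (T \<omega>) + m\<^sup>2 * (grid_time n (T \<omega>))\<^sup>2"
      unfolding R_grid using P(2)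
      by (intro AE_I2) (simp add: power2_eq_square grid_time_nonneg)
    have h: "integrable M (\<lambda>\<omega>. A * grid_time n (T \<omega>) + m\<^sup>2 * (grid_time n (T \<omega>))\<^sup>2)"
      using grid_time_square_integrable(1)[OF T T_nonneg, of n]
        square_integrable_integrable[OF grid_time_square_integrable(1)[OF T T_nonneg, of n]]
      by (simp add: square_integrable_def)
    show "integrable M (\<lambda>\<omega>. (W (grid_time n (T \<omega>)) \<omega>)\<^sup>2)"
      using random_index_bound(1)[OF grid_indep[of n], of ?f, OF f_meas f_int bound h] unfolding R_grid .
  qed measurable
  have cauchy: "(\<integral>\<^sup>+\<omega>. ennreal ((W (grid_time n (T \<omega>)) \<omega> - W (grid_time k (T \<omega>)) \<omega>)\<^sup>2) \<partial>M) \<le>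
      ennreal (\<bar>A\<bar> / real (Suc n) + m\<^sup>2 * (1 / real (Suc n))\<^sup>2)" if "n \<le> k" for k
  proof -
    let ?f = "\<lambda>x j. (x (real (fst j) / real (Suc n)) - x (real (snd j) / real (Suc k)) :: real)\<^sup>2"
    have f_meas: "(\<lambda>x. ?f x j) \<in> borel_measurable (PiM {0..} (\<lambda>_. borel))" for j
      by (intro borel_measurable_power borel_measurable_diff component_meas)
    have f_int: "integrable M (\<lambda>\<omega>. ?f (R \<omega>) j)" for j
      unfolding R_nat by (rule linear_covariance_diff(1)[OF lc]) auto
    have bound: "AE \<omega> in M. (\<integral>\<omega>'. \<bar>?f (R \<omega>') (grid_index n (T \<omega>), grid_index k (T \<omega>))\<bar> \<partial>M) \<le>
        \<bar>A\<bar> / real (Suc n) + m\<^sup>2 * (1 / real (Suc n))\<^sup>2"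
      using T_nonneg
    proof eventually_elim
      case (elim \<omega>)
      let ?d = "grid_time n (T \<omega>) - grid_time k (T \<omega>)"
      note d = grid_time_dist[OF elim that]
      have "(\<integral>\<omega>'. (W (grid_time n (T \<omega>)) \<omega>' - W (grid_time k (T \<omega>)) \<omega>')\<^sup>2 \<partial>M) = A * \<bar>?d\<bar> + m\<^sup>2 * ?d\<^sup>2"
        by (rule linear_covariance_diff(2)[OF lc grid_time_nonneg grid_time_nonneg])
      also have "\<dots> \<le> \<bar>A\<bar> * (1 / real (Suc n)) + m\<^sup>2 * (1 / real (Suc n))\<^sup>2"
        using d power_mono[OF d, of 2] by (intro add_mono mult_mono) auto
      finally show ?case
        unfolding fst_conv snd_conv R_grid by simp
    qed
    have h: "integrable M (\<lambda>\<omega>. \<bar>A\<bar> / real (Suc n) + m\<^sup>2 * (1 / real (Suc n))\<^sup>2)"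
      by simp
    note * = random_index_bound[OF grid_indep2[of n k], of ?f, OF f_meas f_int bound h,
        unfolded fst_conv snd_conv R_grid]
    show ?thesis
      using *(2) by (subst nn_integral_eq_integral[OF *(1)]) (auto simp: prob_space simp del: ennreal_plus intro: ennreal_leI)
  qed
  show "(\<integral>\<^sup>+\<omega>. ennreal ((W (grid_time n (T \<omega>)) \<omega> - W (T \<omega>) \<omega>)\<^sup>2) \<partial>M) \<le>
       ennreal (\<bar>A\<bar> / real (Suc n) + m\<^sup>2 * (1 / real (Suc n))\<^sup>2)"
  proof (rule nn_integral_le_of_AE_tendsto)
    show "AE \<omega> in M. (\<lambda>k. ennreal ((W (grid_time n (T \<omega>)) \<omega> - W (grid_time k (T \<omega>)) \<omega>)\<^sup>2)) \<longlonglongrightarrow>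
        ennreal ((W (grid_time n (T \<omega>)) \<omega> - W (T \<omega>) \<omega>)\<^sup>2)"
      using grid_sample_tendsto by eventually_elim (intro tendsto_intros)
    show "\<forall>\<^sub>F k in sequentially.
        (\<integral>\<^sup>+\<omega>. ennreal ((W (grid_time n (T \<omega>)) \<omega> - W (grid_time k (T \<omega>)) \<omega>)\<^sup>2) \<partial>M) \<le>
        ennreal (\<bar>A\<bar> / real (Suc n) + m\<^sup>2 * (1 / real (Suc n))\<^sup>2)"
      using cauchy unfolding eventually_sequentially by blast
  qed measurable
qed

lemma time_change_square_integrable:
  assumes lc: "linear_covariance M W m A" and T: "square_integrable M T"
  shows "square_integrable M (\<lambda>\<omega>. W (T \<omega>) \<omega>)"
  by (rule L2_limit(1)[OF grid_sample_L2(1)[OF lc T] WT grid_sample_L2(2)[OF lc T]]) auto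

end

text \<open>The identity is exact at the grid times, and every expectation in it is an L2 inner
  product, so both sides converge as the mesh shrinks.\<close>

lemma time_change_product:
  fixes W :: "real \<Rightarrow> 'a \<Rightarrow> real" and T T' :: "'a \<Rightarrow> real"
  assumes ind: "indep_pair M (PiM {0..} (\<lambda>_. borel)) (\<lambda>\<omega>. \<lambda>r\<in>{0..}. W r \<omega>) (borel \<Otimes>\<^sub>M borel) (\<lambda>\<omega>. (T \<omega>, T' \<omega>))"
    and rc: "AE \<omega> in M. \<forall>t\<ge>0. ((\<lambda>r. W r \<omega>) \<longlongrightarrow> W t \<omega>) (at_right t)"
    and T_nonneg: "AE \<omega> in M. 0 \<le> T \<omega>" and T_le: "AE \<omega> in M. T \<omega> \<le> T' \<omega>"
    and WT: "(\<lambda>\<omega>. W (T \<omega>) \<omega>) \<in> borel_measurable M" and WT': "(\<lambda>\<omega>. W (T' \<omega>) \<omega>) \<in> borel_measurable M"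
    and lc: "linear_covariance M W m A"
    and T: "square_integrable M T" and T': "square_integrable M T'"
  shows "(\<integral>\<omega>. W (T \<omega>) \<omega> * W (T' \<omega>) \<omega> \<partial>M) = A * (\<integral>\<omega>. T \<omega> \<partial>M) + m\<^sup>2 * (\<integral>\<omega>. T \<omega> * T' \<omega> \<partial>M)"
proof -
  let ?R = "\<lambda>\<omega>. \<lambda>r\<in>{0..}. W r \<omega>"
  let ?D = "\<lambda>n \<omega>. grid_time n (T \<omega>)" and ?D' = "\<lambda>n \<omega>. grid_time n (T' \<omega>)"
  let ?a = "\<lambda>n. \<bar>A\<bar> / real (Suc n) + m\<^sup>2 * (1 / real (Suc n))\<^sup>2" and ?b = "\<lambda>n. (1 / real (Suc n))\<^sup>2"
  have T'_nonneg: "AE \<omega> in M. 0 \<le> T' \<omega>"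
    using T_nonneg T_le by eventually_elim simp
  have ind1: "indep_pair M (PiM {0..} (\<lambda>_. borel)) ?R borel T"
    and ind2: "indep_pair M (PiM {0..} (\<lambda>_. borel)) ?R borel T'"
    using indep_pair_compose[OF ind measurable_ident measurable_fst]
      indep_pair_compose[OF ind measurable_ident measurable_snd] by simp_all
  have ind_grid: "indep_pair M (PiM {0..} (\<lambda>_. borel)) ?R (count_space UNIV)
      (\<lambda>\<omega>. (grid_index n (T \<omega>), grid_index n (T' \<omega>)))" for n
    using indep_pair_compose[OF ind measurable_ident measurable_Pair_count_space[OF
          measurable_compose[OF measurable_fst grid_index_measurable]
          measurable_compose[OF measurable_snd grid_index_measurable], of n n]]
    by simp
  note W1 = grid_sample_L2[OF ind1 rc T_nonneg WT lc T]
    and W2 = grid_sample_L2[OF ind2 rc T'_nonneg WT' lc T']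
  note D1 = grid_time_square_integrable[OF T T_nonneg]
    and D2 = grid_time_square_integrable[OF T' T'_nonneg]
  note P = linear_covariance_product[OF lc]
  have grid: "(\<integral>\<omega>. W (?D n \<omega>) \<omega> * W (?D' n \<omega>) \<omega> \<partial>M) =
      A * (\<integral>\<omega>. ?D n \<omega> \<partial>M) + m\<^sup>2 * (\<integral>\<omega>. ?D n \<omega> * ?D' n \<omega> \<partial>M)" for n
  proof -
    let ?f = "\<lambda>x j. x (real (fst j) / real (Suc n)) * x (real (snd j) / real (Suc n)) :: real"
    have R: "?R \<omega> (real (grid_index n y) / real (Suc n)) = W (grid_time n y) \<omega>" for \<omega> y
      by (simp add: grid_time_def)
    have f_meas: "(\<lambda>x. ?f x j) \<in> borel_measurable (PiM {0..} (\<lambda>_. borel))" for j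
      by (intro borel_measurable_times measurable_component_singleton) auto
    have int: "integrable M (\<lambda>\<omega>. ?f (?R \<omega>) (grid_index n (T \<omega>), grid_index n (T' \<omega>)))"
      unfolding fst_conv snd_conv R by (rule square_integrable_mult[OF W1(1) W2(1)])
    have D_int: "integrable M (?D n)" "integrable M (\<lambda>\<omega>. ?D n \<omega> * ?D' n \<omega>)"
      by (rule square_integrable_integrable[OF D1(1)], rule square_integrable_mult[OF D1(1) D2(1)])
    \<comment> \<open>Rounding to a common grid preserves the order of the two times, so the minimum
      in the product moment is the earlier one.\<close>
    have mean: "AE \<omega> in M. (\<integral>\<omega>'. ?f (?R \<omega>') (grid_index n (T \<omega>), grid_index n (T' \<omega>)) \<partial>M) =
        A * ?D n \<omega> + m\<^sup>2 * (?D n \<omega> * ?D' n \<omega>)"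
      using T_le
    proof eventually_elim
      case (elim \<omega>)
      then show ?case
        unfolding fst_conv snd_conv R
        using P(2)[OF grid_time_nonneg grid_time_nonneg, of n "T \<omega>" n "T' \<omega>"] grid_time_mono[OF elim, of n]
        by (simp add: min_def)
    qed
    have "(\<lambda>\<omega>. A * ?D n \<omega> + m\<^sup>2 * (?D n \<omega> * ?D' n \<omega>)) \<in> borel_measurable M"
      using D_int by auto
    from random_index_expectation[OF ind_grid[of n], of ?f, OF f_meas int this mean]
    show ?thesis
      unfolding fst_conv snd_conv R using D_int by simp
  qed
  have "(\<lambda>n. \<bar>A\<bar> * (1 / real (Suc n)) + m\<^sup>2 * (1 / real (Suc n))\<^sup>2) \<longlonglongrightarrow> \<bar>A\<bar> * 0 + m\<^sup>2 * 0\<^sup>2"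
    by (intro tendsto_intros LIMSEQ_Suc lim_1_over_n)
  then have a: "?a \<longlonglongrightarrow> 0" by simp
  have "(\<lambda>n. (1 / real (Suc n))\<^sup>2) \<longlonglongrightarrow> 0\<^sup>2"
    by (intro tendsto_intros LIMSEQ_Suc lim_1_over_n)
  then have b: "?b \<longlonglongrightarrow> 0" by simp
  \<comment> \<open>Pairing with the constant 1 turns a first moment into an inner product, so that
    \<open>L2_limit_product\<close> also gives the limit of the means.\<close>
  have one: "square_integrable M (\<lambda>_. 1 :: real)"
    by (simp add: square_integrable_def)
  have T_meas: "T \<in> borel_measurable M" "T' \<in> borel_measurable M"
    using T T' by (auto simp: square_integrable_def)
  have "(\<lambda>n. \<integral>\<omega>. ?D n \<omega> * 1 \<partial>M) \<longlonglongrightarrow> (\<integral>\<omega>. T \<omega> * 1 \<partial>M)"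
    by (rule L2_limit_product[OF D1(1) T_meas(1) D1(2) _ b one]) auto
  moreover have "(\<lambda>n. \<integral>\<omega>. ?D n \<omega> * ?D' n \<omega> \<partial>M) \<longlonglongrightarrow> (\<integral>\<omega>. T \<omega> * T' \<omega> \<partial>M)"
    by (rule L2_limit_product[OF D1(1) T_meas(1) D1(2) _ b D2(1) T_meas(2) D2(2)]) auto
  ultimately have "(\<lambda>n. \<integral>\<omega>. W (?D n \<omega>) \<omega> * W (?D' n \<omega>) \<omega> \<partial>M) \<longlonglongrightarrow>
      A * (\<integral>\<omega>. T \<omega> \<partial>M) + m\<^sup>2 * (\<integral>\<omega>. T \<omega> * T' \<omega> \<partial>M)"
    unfolding grid by (intro tendsto_intros) simp_all
  moreover have "(\<lambda>n. \<integral>\<omega>. W (?D n \<omega>) \<omega> * W (?D' n \<omega>) \<omega> \<partial>M) \<longlonglongrightarrow>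
      (\<integral>\<omega>. W (T \<omega>) \<omega> * W (T' \<omega>) \<omega> \<partial>M)"
    by (rule L2_limit_product[OF W1(1) WT W1(2) _ a W2(1) WT' W2(2)]) auto
  ultimately show ?thesis
    by (rule LIMSEQ_unique[rotated])
qed

end

section \<open>The first exit time\<close>

text \<open>The termwise derivative of the geometric series, inside its disc of convergence.\<close>

lemma summable_linear_geometric:
  fixes q :: real
  assumes "\<bar>q\<bar> < 1"
  shows "summable (\<lambda>n. real (Suc n) * q ^ n)"
  using termdiff_converges[of q 1 "\<lambda>_. 1"] assms
  by (simp add: diffs_def summable_geometric)

lemma first_exit_le:
  assumes "0 \<le> r" "t < S r \<omega>"
  shows "first_exit S t \<omega> \<le> r"
  unfolding first_exit_def using assms by (intro cInf_lower bdd_belowI[of _ 0]) auto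

context prob_space
begin

context
  fixes S :: "real \<Rightarrow> 'a \<Rightarrow> real" and q :: real
  assumes S_meas: "\<And>n::nat. S (real n) \<in> borel_measurable M"
    and laplace: "\<And>n::nat. (\<integral>\<omega>. exp (- S (real n) \<omega>) \<partial>M) = q ^ n"
    and q: "0 < q" "q < 1"
begin

text \<open>The exponential Markov inequality: on the event, exp(t - S(n)) is at least 1.\<close>

lemma prob_le_exp: "prob {\<omega>\<in>space M. S (real n) \<omega> \<le> t} \<le> exp t * q ^ n"
proof -
  note [measurable] = S_meas
  \<comment> \<open>The integral of a non-integrable function is 0 by convention, whereas
    \<open>q ^ n\<close> is positive.\<close>
  have int: "integrable M (\<lambda>\<omega>. exp (- S (real n) \<omega>))"
    using laplace[of n] q not_integrable_integral_eq by fastforce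
  have "prob {\<omega>\<in>space M. S (real n) \<omega> \<le> t} = (\<integral>\<omega>. indicator {\<omega>\<in>space M. S (real n) \<omega> \<le> t} \<omega> \<partial>M)"
    by simp
  also have "\<dots> \<le> (\<integral>\<omega>. exp t * exp (- S (real n) \<omega>) \<partial>M)"
  proof (rule integral_mono)
    show "integrable M (\<lambda>\<omega>. exp t * exp (- S (real n) \<omega>))"
      using int by (rule integrable_mult_right)
    show "integrable M (indicator {\<omega>\<in>space M. S (real n) \<omega> \<le> t} :: 'a \<Rightarrow> real)"
      by (rule integrable_real_indicator) (auto simp: emeasure_eq_measure)
    show "indicator {\<omega>\<in>space M. S (real n) \<omega> \<le> t} \<omega> \<le> exp t * exp (- S (real n) \<omega>)" for \<omega>
      by (auto simp: indicator_def exp_add[symmetric])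
  qed
  also have "\<dots> = exp t * q ^ n"
    using laplace by simp
  finally show ?thesis .
qed

text \<open>Borel-Cantelli along integer times, the probabilities being dominated by a geometric
  series. Thus the infimum defining \<open>first_exit\<close> is almost surely taken over a nonempty
  set, where it has its intended meaning.\<close>

lemma AE_passage: "AE \<omega> in M. \<exists>r\<ge>0. t < S r \<omega>"
proof -
  note [measurable] = S_meas
  have "summable (\<lambda>n. prob {\<omega>\<in>space M. S (real n) \<omega> \<le> t})"
  proof (rule summable_comparison_test')
    show "summable (\<lambda>n. exp t * q ^ n)"
      using q by (intro summable_mult summable_geometric) auto
    show "norm (prob {\<omega>\<in>space M. S (real n) \<omega> \<le> t}) \<le> exp t * q ^ n" if "0 \<le> n" for n
      using prob_le_exp by simp
  qed
  then have "AE \<omega> in M. \<forall>\<^sub>F n in sequentially. \<omega> \<in> space M - {\<omega>\<in>space M. S (real n) \<omega> \<le> t}"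
    by (intro borel_cantelli_AE1) (auto simp: emeasure_eq_measure)
  then show ?thesis
  proof eventually_elim
    case (elim \<omega>)
    then obtain n where "\<omega> \<in> space M - {\<omega>\<in>space M. S (real n) \<omega> \<le> t}"
      by (auto simp: eventually_sequentially)
    then show ?case
      by (intro exI[of _ "real n"]) auto
  qed
qed

lemma AE_first_exit_nonneg: "AE \<omega> in M. 0 \<le> first_exit S t \<omega>"
  using AE_passage[of t] unfolding first_exit_def
  by eventually_elim (auto intro!: cInf_greatest)

lemma AE_first_exit_mono:
  assumes "s \<le> t"
  shows "AE \<omega> in M. first_exit S s \<omega> \<le> first_exit S t \<omega>"
  using AE_passage[of t]
proof eventually_elim
  case (elim \<omega>)
  then show ?case
    unfolding first_exit_def using assms by (intro cInf_superset_mono bdd_belowI[of _ 0]) auto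
qed

text \<open>With \<open>m = \<lceil>E(t)\<rceil>\<close>, every \<open>n < m\<close> satisfies \<open>S(n) \<le> t\<close>, and \<open>m\<^sup>2\<close> is the sum of the first \<open>m\<close>
  odd numbers.\<close>

lemma first_exit_square_le:
  assumes "0 \<le> first_exit S t \<omega>"
  shows "ennreal ((first_exit S t \<omega>)\<^sup>2) \<le> (\<Sum>n. ennreal (real (2 * n + 1)) * indicator {\<omega>. S (real n) \<omega> \<le> t} \<omega>)"
proof -
  let ?e = "first_exit S t \<omega>"
  define m where "m = nat \<lceil>?e\<rceil>"
  have "real m ^ 2 = (\<Sum>n<m. real (2 * n + 1))"
    by (induction m) (auto simp: power2_eq_square algebra_simps)
  moreover have "?e \<le> real m"
    unfolding m_def by linarith
  ultimately have "?e\<^sup>2 \<le> (\<Sum>n<m. real (2 * n + 1))"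
    using power_mono[OF _ assms, of "real m" 2] by simp
  then have "ennreal (?e\<^sup>2) \<le> (\<Sum>n<m. ennreal (real (2 * n + 1)))"
    by (subst sum_ennreal) (auto intro: ennreal_leI)
  also have "\<dots> = (\<Sum>n<m. ennreal (real (2 * n + 1)) * indicator {\<omega>. S (real n) \<omega> \<le> t} \<omega>)"
  proof (rule sum.cong[OF refl])
    fix n assume "n \<in> {..<m}"
    then have "real n < ?e"
      unfolding m_def by (simp add: zless_nat_eq_int_zless) linarith
    \<comment> \<open>Otherwise level \<open>t\<close> would be exceeded at time \<open>n\<close>,
      and the exit time would be at most \<open>n\<close>.\<close>
    then have "S (real n) \<omega> \<le> t"
      using first_exit_le[of "real n" t S \<omega>] by (auto simp: not_le[symmetric])
    then show "ennreal (real (2 * n + 1)) = ennreal (real (2 * n + 1)) * indicator {\<omega>. S (real n) \<omega> \<le> t} \<omega>"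
      by simp
  qed
  also have "\<dots> \<le> (\<Sum>n. ennreal (real (2 * n + 1)) * indicator {\<omega>. S (real n) \<omega> \<le> t} \<omega>)"
    by (rule sum_le_suminf) auto
  finally show ?thesis .
qed

text \<open>Integrating the pointwise bound termwise gives the series of (2n + 1) P(S(n) <= t),
  which the exponential bound compares with a differentiated geometric series.\<close>

lemma first_exit_square_integrable:
  assumes [measurable]: "first_exit S t \<in> borel_measurable M"
  shows "square_integrable M (first_exit S t)"
proof -
  note [measurable] = S_meas
  let ?A = "\<lambda>n. {\<omega>\<in>space M. S (real n) \<omega> \<le> t}"
  have summable: "summable (\<lambda>n. 2 * exp t * (real (Suc n) * q ^ n))"
    using q by (intro summable_mult summable_linear_geometric) auto
  have "(\<integral>\<^sup>+\<omega>. ennreal ((first_exit S t \<omega>)\<^sup>2) \<partial>M) \<le>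
      (\<integral>\<^sup>+\<omega>. (\<Sum>n. ennreal (real (2 * n + 1)) * indicator (?A n) \<omega>) \<partial>M)"
  proof (rule nn_integral_mono_AE)
    show "AE \<omega> in M. ennreal ((first_exit S t \<omega>)\<^sup>2) \<le>
        (\<Sum>n. ennreal (real (2 * n + 1)) * indicator (?A n) \<omega>)"
      using AE_first_exit_nonneg[of t] AE_space
    proof eventually_elim
      case (elim \<omega>)
      then have "indicator (?A n) \<omega> = (indicator {\<omega>. S (real n) \<omega> \<le> t} \<omega> :: ennreal)" for n
        by (auto simp: indicator_def)
      then show ?case
        using first_exit_square_le[OF elim(1)] by simp
    qed
  qed
  also have "\<dots> = (\<Sum>n. ennreal (real (2 * n + 1)) * emeasure M (?A n))"
    by (subst nn_integral_suminf) (auto simp: nn_integral_cmult_indicator)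
  also have "\<dots> \<le> (\<Sum>n. ennreal (2 * exp t * (real (Suc n) * q ^ n)))"
  proof (rule suminf_le)
    fix n
    \<comment> \<open>Enlarging 2n + 1 to 2(n + 1) gives the form treated by
      \<open>summable_linear_geometric\<close>.\<close>
    have "real (2 * n + 1) * prob (?A n) \<le> (2 * real (Suc n)) * (exp t * q ^ n)"
      using prob_le_exp[of n t] by (intro mult_mono) auto
    then show "ennreal (real (2 * n + 1)) * emeasure M (?A n) \<le> ennreal (2 * exp t * (real (Suc n) * q ^ n))"
      unfolding emeasure_eq_measure
      by (subst ennreal_mult[symmetric]) (auto intro!: ennreal_leI simp: mult_ac simp del: of_nat_Suc of_nat_add of_nat_mult)
  qed auto
  also have "\<dots> < \<infinity>"
    using summable q by (subst suminf_ennreal2) auto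
  finally show ?thesis
    unfolding square_integrable_def by (auto intro!: integrableI_bounded)
qed

end

end

section \<open>Poisson processes of order k\<close>

lemma linear_mean_cong:
  assumes "\<And>r \<omega>. 0 \<le> r \<Longrightarrow> \<omega> \<in> space M \<Longrightarrow> W r \<omega> = W' r \<omega>"
  shows "linear_mean M W m C \<longleftrightarrow> linear_mean M W' m C"
proof -
  have "integrable M (W r) \<longleftrightarrow> integrable M (W' r)" "(\<integral>\<omega>. W r \<omega> \<partial>M) = (\<integral>\<omega>. W' r \<omega> \<partial>M)" if "0 \<le> r" for r
    using assms[OF that] by (auto intro!: Bochner_Integration.integrable_cong Bochner_Integration.integral_cong)
  moreover have "(\<integral>\<omega>. \<bar>W r' \<omega> - W r \<omega>\<bar> \<partial>M) = (\<integral>\<omega>. \<bar>W' r' \<omega> - W' r \<omega>\<bar> \<partial>M)" if "0 \<le> r" "0 \<le> r'" for r r'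
    using assms[OF that(1)] assms[OF that(2)] by (auto intro!: Bochner_Integration.integral_cong)
  ultimately show ?thesis
    by (simp add: linear_mean_def)
qed

lemma linear_covariance_cong:
  assumes "\<And>r \<omega>. 0 \<le> r \<Longrightarrow> \<omega> \<in> space M \<Longrightarrow> W r \<omega> = W' r \<omega>"
  shows "linear_covariance M W m A \<longleftrightarrow> linear_covariance M W' m A"
proof -
  have "square_integrable M (W r) \<longleftrightarrow> square_integrable M (W' r)" if "0 \<le> r" for r
    unfolding square_integrable_def using assms[OF that]
    by (intro conj_cong measurable_cong Bochner_Integration.integrable_cong) auto
  moreover have "(\<integral>\<omega>. W r \<omega> * W r' \<omega> \<partial>M) = (\<integral>\<omega>. W' r \<omega> * W' r' \<omega> \<partial>M)" if "0 \<le> r" "0 \<le> r'" for r r'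
    using assms[OF that(1)] assms[OF that(2)] by (auto intro!: Bochner_Integration.integral_cong)
  ultimately show ?thesis
    by (simp add: linear_covariance_def)
qed

lemma measurable_nat_component:
  assumes "i \<in> I"
  shows "(\<lambda>x. x i :: nat) \<in> PiM I (\<lambda>_. borel) \<rightarrow>\<^sub>M count_space UNIV"
proof -
  have "(\<lambda>x. x i :: nat) \<in> PiM I (\<lambda>_. borel) \<rightarrow>\<^sub>M borel"
    using assms by (rule measurable_component_singleton)
  then show ?thesis
    using measurable_cong_sets[OF refl sets_borel_eq_count_space] by blast
qed

text \<open>The map \<open>f\<close> acts on the whole family at once, so its entries can be
  converted, for instance from naturals to reals, before pairing with two values of
  \<open>N\<close>.\<close>

lemma (in prob_space) indep_families_index_pair:
  fixes N :: "real \<Rightarrow> 'a \<Rightarrow> nat"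
  assumes ind: "indep_families M I X {0..} N" and f: "f \<in> PiM I (\<lambda>_. borel) \<rightarrow>\<^sub>M S"
    and "0 \<le> r" "0 \<le> r'"
  shows "indep_pair M S (\<lambda>\<omega>. f (\<lambda>i\<in>I. X i \<omega>)) (count_space UNIV) (\<lambda>\<omega>. (N r \<omega>, N r' \<omega>))"
proof -
  have "(\<lambda>x. (x r :: nat, x r' :: nat)) \<in> PiM {0..} (\<lambda>_. borel) \<rightarrow>\<^sub>M count_space UNIV"
    using assms by (intro measurable_Pair_count_space measurable_nat_component) auto
  from indep_pair_compose[OF indep_families_imp_indep_pair[OF ind] f this] show ?thesis
    using assms by simp
qed

lemma (in prob_space) indep_vars_integral_mult:
  fixes Y :: "'i \<Rightarrow> 'a \<Rightarrow> real"
  assumes ind: "indep_vars (\<lambda>_. borel) Y I" and "i \<in> I" "j \<in> I" "i \<noteq> j"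
    and "integrable M (Y i)" "integrable M (Y j)"
  shows "(\<integral>\<omega>. Y i \<omega> * Y j \<omega> \<partial>M) = (\<integral>\<omega>. Y i \<omega> \<partial>M) * (\<integral>\<omega>. Y j \<omega> \<partial>M)"
  using indep_vars_lebesgue_integral[of "{i, j}" Y] indep_vars_subset[OF ind, of "{i, j}"] assms
  by auto

lemma (in prob_space) covariance_eq:
  assumes "square_integrable M X" "square_integrable M Y"
  shows "covariance M X Y = (\<integral>\<omega>. X \<omega> * Y \<omega> \<partial>M) - (\<integral>\<omega>. X \<omega> \<partial>M) * (\<integral>\<omega>. Y \<omega> \<partial>M)"
proof -
  let ?a = "\<integral>\<omega>. X \<omega> \<partial>M" and ?b = "\<integral>\<omega>. Y \<omega> \<partial>M"
  have int: "integrable M X" "integrable M Y" "integrable M (\<lambda>\<omega>. X \<omega> * Y \<omega>)"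
    using assms by (auto intro: square_integrable_integrable square_integrable_mult)
  have "covariance M X Y = (\<integral>\<omega>. X \<omega> * Y \<omega> - ?b * X \<omega> - ?a * Y \<omega> + ?a * ?b \<partial>M)"
    unfolding covariance_def by (intro Bochner_Integration.integral_cong) (auto simp: algebra_simps)
  also have "\<dots> = (\<integral>\<omega>. X \<omega> * Y \<omega> \<partial>M) - ?a * ?b"
    using int by (simp add: prob_space)
  finally show ?thesis .
qed

lemma integral_pmf_of_set_atLeastAtMost:
  assumes "1 \<le> k"
  shows "(\<integral>n. real n \<partial>measure_pmf (pmf_of_set {1..k})) = (real k + 1) / 2"
proof -
  have "(\<Sum>n=1..k. real n) = real k * (real k + 1) / 2"
    by (induction k) (auto simp: field_simps)
  then show ?thesis
    using assms by (subst integral_pmf_of_set) auto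
qed

context prob_space
begin

text \<open>The jumps are natural numbers, so paths inherit monotonicity from the Poisson process,
  and the L1 increment constant coincides with the mean rate. Local constancy to the right is
  recorded instead of right-continuity, because the index of a random sum has to be literally
  unchanged.\<close>

lemma
  assumes "PPoK M k lam Nk" "1 \<le> k" "0 < lam"
  shows PPoK_mono: "\<And>r r'. 0 \<le> r \<Longrightarrow> r \<le> r' \<Longrightarrow> AE \<omega> in M. Nk r \<omega> \<le> Nk r' \<omega>"
    and PPoK_right_constant:
      "AE \<omega> in M. \<forall>t\<ge>0. eventually (\<lambda>r. Nk r \<omega> = Nk t \<omega>) (at_right t)"
    and PPoK_linear_mean: "linear_mean M (\<lambda>r \<omega>. real (Nk r \<omega>))
      ((real k + 1) / 2 * (real k * lam)) ((real k + 1) / 2 * (real k * lam))"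
    and PPoK_linear_covariance:
      "\<exists>A. linear_covariance M (\<lambda>r \<omega>. real (Nk r \<omega>)) ((real k + 1) / 2 * (real k * lam)) A"
proof -
  obtain N X where N: "poisson_process M (real k * lam) N"
    and X_indep: "indep_vars (\<lambda>_. count_space UNIV) X {1::nat..}"
    and X_law: "\<And>i. 1 \<le> i \<Longrightarrow> distr M (count_space UNIV) (X i) = measure_pmf (pmf_of_set {1..k})"
    and XN: "indep_families M {1..} X {0..} N"
    and Nk: "\<And>t \<omega>. 0 \<le> t \<Longrightarrow> \<omega> \<in> space M \<Longrightarrow> Nk t \<omega> = (\<Sum>i=1..N t \<omega>. X i \<omega>)"
    using assms(1) unfolding PPoK_def by auto
  define \<nu> where "\<nu> = real k * lam"
  have \<nu>: "0 < \<nu>" using assms by (simp add: \<nu>_def)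
  note N = N[folded \<nu>_def]
  note N_mono = poisson_process_mono[OF N \<nu>]
  show "AE \<omega> in M. Nk r \<omega> \<le> Nk r' \<omega>" if "0 \<le> r" "r \<le> r'" for r r'
    using N_mono[OF that] AE_space
    by eventually_elim (use that in \<open>auto simp: Nk intro!: sum_mono2\<close>)
  have "AE \<omega> in M. \<forall>t\<ge>0. continuous (at_right t) (\<lambda>r. real (N r \<omega>))"
    using N unfolding poisson_process_def levy_process_def by (auto elim: eventually_mono)
  with AE_space show "AE \<omega> in M. \<forall>t\<ge>0. eventually (\<lambda>r. Nk r \<omega> = Nk t \<omega>) (at_right t)"
  proof (eventually_elim, intro allI impI)
    fix \<omega> and t :: real
    assume \<omega>: "\<omega> \<in> space M" and c: "\<forall>t\<ge>0. continuous (at_right t) (\<lambda>r. real (N r \<omega>))" and t: "0 \<le> t"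
    have "((\<lambda>r. real (N r \<omega>)) \<longlongrightarrow> real (N t \<omega>)) (at_right t)"
      using c t by (auto simp: continuous_within)
    \<comment> \<open>Natural numbers at distance below 1 are equal, so right-continuity becomes
      local constancy.\<close>
    then have "\<forall>\<^sub>F r in at_right t. dist (real (N r \<omega>)) (real (N t \<omega>)) < 1"
      by (rule tendstoD) simp
    moreover have "\<forall>\<^sub>F r in at_right t. t < r"
      by (rule eventually_at_right_less)
    ultimately show "\<forall>\<^sub>F r in at_right t. Nk r \<omega> = Nk t \<omega>"
    proof eventually_elim
      case (elim r)
      then have "N r \<omega> = N t \<omega>"
        by (auto simp: dist_real_def)
      then show ?case
        using elim t \<omega> by (simp add: Nk)
    qed
  qed
  let ?X = "\<lambda>i \<omega>. real (X i \<omega>)"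
  let ?L = "measure_pmf (pmf_of_set {1..k})"
  have X_meas: "X i \<in> M \<rightarrow>\<^sub>M count_space UNIV" if "1 \<le> i" for i
    using X_indep that by (auto simp: indep_vars_def)
  have transfer: "has_bochner_integral M (\<lambda>\<omega>. g (X i \<omega>)) (\<integral>n. g n \<partial>?L)" if "1 \<le> i" for i and g :: "nat \<Rightarrow> real"
  proof -
    have "integrable ?L g"
      using assms(2) by (intro integrable_measure_pmf_finite) simp
    then show ?thesis
      using X_law[OF that] X_meas[OF that]
        integrable_distr_eq[OF X_meas[OF that], of g] integral_distr[OF X_meas[OF that], of g]
      by (simp add: has_bochner_integral_iff)
  qed
  define a where "a = (real k + 1) / 2"
  \<comment> \<open>The variance of the uniform law, kept symbolic since only the existence of a
    covariance constant is claimed.\<close>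
  define v where "v = (\<integral>n. real n * real n \<partial>?L) - a\<^sup>2"
  have X_int: "integrable M (?X i)" and X_mean: "(\<integral>\<omega>. ?X i \<omega> \<partial>M) = a"
    and X_abs: "(\<integral>\<omega>. \<bar>?X i \<omega>\<bar> \<partial>M) = a"
    and X_sq: "square_integrable M (?X i)" if "1 \<le> i" for i
    using transfer[OF that, of real] transfer[OF that, of "\<lambda>n. (real n)\<^sup>2"] X_meas[OF that]
      integral_pmf_of_set_atLeastAtMost[OF assms(2)]
    by (auto simp: has_bochner_integral_iff a_def square_integrable_def)
  have X_indep': "indep_vars (\<lambda>_. borel) ?X {1..}"
    using X_indep by (rule indep_vars_compose2) simp
  have X_cov: "(\<integral>\<omega>. ?X i \<omega> * ?X j \<omega> \<partial>M) = a\<^sup>2 + (if i = j then v else 0)" if "1 \<le> i" "1 \<le> j" for i j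
    using indep_vars_integral_mult[OF X_indep', of i j] X_int X_mean that
      transfer[OF that(1), of "\<lambda>n. real n * real n"]
    by (auto simp: has_bochner_integral_iff v_def power2_eq_square)
  have ind: "indep_pair M (PiM {1..} (\<lambda>_. borel)) (\<lambda>\<omega>. \<lambda>i\<in>{1..}. ?X i \<omega>) (count_space UNIV) (\<lambda>\<omega>. (N r \<omega>, N r' \<omega>))"
    if "0 \<le> r" "0 \<le> r'" for r r'
  proof -
    let ?f = "\<lambda>x. \<lambda>i\<in>{1::nat..}. real (x i)"
    have "?f \<in> PiM {1..} (\<lambda>_. borel) \<rightarrow>\<^sub>M PiM {1..} (\<lambda>_. borel)"
      by (intro measurable_restrict measurable_compose[OF measurable_nat_component]) auto
    from indep_families_index_pair[OF XN this that]
    show ?thesis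
      by (simp cong: restrict_cong)
  qed
  note N_lin = poisson_process_linear_mean[OF N \<nu>]
  have mean: "linear_mean M (\<lambda>r \<omega>. \<Sum>i=1..N r \<omega>. ?X i \<omega>) (a * \<nu>) (a * \<nu>)"
    by (rule random_sum_linear_mean[OF ind N_mono N_lin X_int X_mean X_abs])
  have cong: "real (Nk r \<omega>) = (\<Sum>i=1..N r \<omega>. ?X i \<omega>)" if "0 \<le> r" "\<omega> \<in> space M" for r \<omega>
    using that by (simp add: Nk)
  have mean_iff: "linear_mean M (\<lambda>r \<omega>. real (Nk r \<omega>)) b C \<longleftrightarrow>
      linear_mean M (\<lambda>r \<omega>. \<Sum>i=1..N r \<omega>. ?X i \<omega>) b C" for b C
    by (rule linear_mean_cong) (rule cong)
  have cov_iff: "linear_covariance M (\<lambda>r \<omega>. real (Nk r \<omega>)) b A \<longleftrightarrow>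
      linear_covariance M (\<lambda>r \<omega>. \<Sum>i=1..N r \<omega>. ?X i \<omega>) b A" for b A
    by (rule linear_covariance_cong) (rule cong)
  show "linear_mean M (\<lambda>r \<omega>. real (Nk r \<omega>)) ((real k + 1) / 2 * (real k * lam)) ((real k + 1) / 2 * (real k * lam))"
    using mean unfolding mean_iff a_def \<nu>_def .
  have "linear_covariance M (\<lambda>r \<omega>. \<Sum>i=1..N r \<omega>. ?X i \<omega>) (a * \<nu>) (v * \<nu> + a\<^sup>2 * \<nu>)"
    using mean by (intro random_sum_linear_covariance[OF ind N_mono N_lin X_int X_mean
      poisson_process_linear_covariance[OF N \<nu>] X_sq X_cov]) (auto simp: linear_mean_def)
  then show "\<exists>A. linear_covariance M (\<lambda>r \<omega>. real (Nk r \<omega>)) ((real k + 1) / 2 * (real k * lam)) A"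
    unfolding cov_iff a_def \<nu>_def by (rule exI)
qed

text \<open>The summands have the law of \<open>Y\<close>, so their moments are those of
  \<open>Y\<close>. The mean rate is the mean jump times the rate (k + 1)/2 * k * lam of the index
  process, and paths move only when the index does.\<close>

lemma
  assumes "CPPoK M k lam H Z" "1 \<le> k" "0 < lam"
    and Y_meas: "Y \<in> borel_measurable M" and Y_law: "cdf (distr M borel Y) = H"
  shows CPPoK_right_continuous:
      "AE \<omega> in M. \<forall>t\<ge>0. ((\<lambda>r. Z r \<omega>) \<longlongrightarrow> Z t \<omega>) (at_right t)"
    and CPPoK_linear_mean: "integrable M Y \<Longrightarrow>
      \<exists>C. linear_mean M Z (real k * (real k + 1) / 2 * lam * (\<integral>\<omega>. Y \<omega> \<partial>M)) C"
    and CPPoK_linear_covariance: "square_integrable M Y \<Longrightarrow>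
      \<exists>A. linear_covariance M Z (real k * (real k + 1) / 2 * lam * (\<integral>\<omega>. Y \<omega> \<partial>M)) A"
proof -
  obtain Nk V where Nk: "PPoK M k lam Nk"
    and V_indep: "indep_vars (\<lambda>_. borel) V {1::nat..}"
    and V_cdf: "\<And>i. 1 \<le> i \<Longrightarrow> cdf (distr M borel (V i)) = H"
    and VN: "indep_families M {1..} V {0..} Nk"
    and Z: "\<And>t \<omega>. 0 \<le> t \<Longrightarrow> \<omega> \<in> space M \<Longrightarrow> Z t \<omega> = (\<Sum>i=1..Nk t \<omega>. V i \<omega>)"
    using assms(1) unfolding CPPoK_def by auto
  show "AE \<omega> in M. \<forall>t\<ge>0. ((\<lambda>r. Z r \<omega>) \<longlongrightarrow> Z t \<omega>) (at_right t)"
    using PPoK_right_constant[OF Nk assms(2,3)] AE_space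
  proof (eventually_elim, intro allI impI)
    fix \<omega> and t :: real
    assume c: "\<forall>t\<ge>0. \<forall>\<^sub>F r in at_right t. Nk r \<omega> = Nk t \<omega>" and \<omega>: "\<omega> \<in> space M" and t: "0 \<le> t"
    have "\<forall>\<^sub>F r in at_right t. Nk r \<omega> = Nk t \<omega>" "\<forall>\<^sub>F r in at_right t. t < r"
      using c t by (auto simp: eventually_at_right_less)
    then have "\<forall>\<^sub>F r in at_right t. Z r \<omega> = Z t \<omega>"
      by eventually_elim (use t \<omega> in \<open>simp add: Z\<close>)
    then show "((\<lambda>r. Z r \<omega>) \<longlongrightarrow> Z t \<omega>) (at_right t)"
      by (rule tendsto_eventually)
  qed
  have mean_iff: "linear_mean M Z b C \<longleftrightarrow> linear_mean M (\<lambda>r \<omega>. \<Sum>i=1..Nk r \<omega>. V i \<omega>) b C" for b C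
    by (rule linear_mean_cong) (rule Z)
  have cov_iff: "linear_covariance M Z b A \<longleftrightarrow> linear_covariance M (\<lambda>r \<omega>. \<Sum>i=1..Nk r \<omega>. V i \<omega>) b A" for b A
    by (rule linear_covariance_cong) (rule Z)
  have V_meas: "V i \<in> borel_measurable M" if "1 \<le> i" for i
    using V_indep that by (auto simp: indep_vars_def)
  \<comment> \<open>The hypothesis gives only equal distribution functions; these determine the law
    on the real line.\<close>
  have V_law: "distr M borel (V i) = distr M borel Y" if "1 \<le> i" for i
    using V_cdf[OF that] Y_law V_meas[OF that] Y_meas
    by (intro cdf_unique) (auto intro!: real_distribution_distr)
  have transfer: "has_bochner_integral M (\<lambda>\<omega>. g (V i \<omega>)) (\<integral>\<omega>. g (Y \<omega>) \<partial>M)"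
    if "1 \<le> i" "integrable M (\<lambda>\<omega>. g (Y \<omega>))" "g \<in> borel_measurable borel" for i and g :: "real \<Rightarrow> real"
    using V_law[OF that(1)] that(2)
      integrable_distr_eq[OF V_meas[OF that(1)] that(3)] integral_distr[OF V_meas[OF that(1)] that(3)]
      integrable_distr_eq[OF Y_meas that(3)] integral_distr[OF Y_meas that(3)]
    by (simp add: has_bochner_integral_iff)
  define \<nu> where "\<nu> = (real k + 1) / 2 * (real k * lam)"
  define m where "m = (\<integral>\<omega>. Y \<omega> \<partial>M)"
  define C where "C = (\<integral>\<omega>. \<bar>Y \<omega>\<bar> \<partial>M)"
  define v where "v = (\<integral>\<omega>. Y \<omega> * Y \<omega> \<partial>M) - m\<^sup>2"
  note ind = indep_families_index_pair[OF VN measurable_ident, unfolded id_apply]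
  note N_mono = PPoK_mono[OF Nk assms(2,3)]
  note N_mean = PPoK_linear_mean[OF Nk assms(2,3), folded \<nu>_def]
  have factor: "real k * (real k + 1) / 2 * lam * (\<integral>\<omega>. Y \<omega> \<partial>M) = m * \<nu>"
    by (simp add: m_def \<nu>_def)
  {
    assume Y: "integrable M Y"
    have V_int: "integrable M (V i)" and V_mean: "(\<integral>\<omega>. V i \<omega> \<partial>M) = m"
      and V_abs: "(\<integral>\<omega>. \<bar>V i \<omega>\<bar> \<partial>M) = C" if "1 \<le> i" for i
      using transfer[OF that, of "\<lambda>x. x"] transfer[OF that, of abs] Y
      by (auto simp: has_bochner_integral_iff m_def C_def)
    show "\<exists>C. linear_mean M Z (real k * (real k + 1) / 2 * lam * (\<integral>\<omega>. Y \<omega> \<partial>M)) C"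
      unfolding mean_iff factor
      by (rule exI, rule random_sum_linear_mean[OF ind N_mono N_mean V_int V_mean V_abs])
  }
  note mean = this
  assume sq: "square_integrable M Y"
  have Y: "integrable M Y" "integrable M (\<lambda>\<omega>. (Y \<omega>)\<^sup>2)"
    using sq by (auto simp: square_integrable_def intro: square_integrable_integrable)
  have V_int: "integrable M (V i)" and V_mean: "(\<integral>\<omega>. V i \<omega> \<partial>M) = m"
    and V_sq: "square_integrable M (V i)" and V_prod: "(\<integral>\<omega>. V i \<omega> * V i \<omega> \<partial>M) = v + m\<^sup>2" if "1 \<le> i" for i
    using transfer[OF that, of "\<lambda>x. x"] transfer[OF that, of "\<lambda>x. x\<^sup>2"] Y V_meas[OF that]
    by (auto simp: has_bochner_integral_iff m_def v_def square_integrable_def power2_eq_square)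
  have V_cov: "(\<integral>\<omega>. V i \<omega> * V j \<omega> \<partial>M) = m\<^sup>2 + (if i = j then v else 0)" if "1 \<le> i" "1 \<le> j" for i j
    using indep_vars_integral_mult[OF V_indep, of i j] V_int V_mean V_prod that
    by (auto simp: power2_eq_square)
  obtain A where A: "linear_covariance M (\<lambda>r \<omega>. real (Nk r \<omega>)) \<nu> A"
    using PPoK_linear_covariance[OF Nk assms(2,3), folded \<nu>_def] by auto
  \<comment> \<open>The mean part, available because \<open>Y\<close> is integrable, provides the
    measurability of the random sums.\<close>
  have Z_meas: "(\<lambda>\<omega>. \<Sum>i=1..Nk r \<omega>. V i \<omega>) \<in> borel_measurable M" if "0 \<le> r" for r
    using mean[OF Y(1)] that unfolding mean_iff by (auto simp: linear_mean_def)
  show "\<exists>A. linear_covariance M Z (real k * (real k + 1) / 2 * lam * (\<integral>\<omega>. Y \<omega> \<partial>M)) A"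
    unfolding cov_iff factor
    by (rule exI, rule random_sum_linear_covariance[OF ind N_mono N_mean V_int V_mean A V_sq V_cov Z_meas])
qed

end

text \<open>Each formula is stated together with the integrability it presupposes, since integrals
  of non-integrable functions default to 0 and would make the formula meaningless.\<close>

theorem theorem3p4:
  fixes M :: "'a measure" and k :: nat
    and lam c\<^sub>1 c\<^sub>2 \<alpha>\<^sub>1 \<alpha>\<^sub>2 \<mu>\<^sub>1 \<mu>\<^sub>2 s t :: real
    and H :: "real \<Rightarrow> real" and Y :: "'a \<Rightarrow> real"
    and S E Z Z2 :: "real \<Rightarrow> 'a \<Rightarrow> real"
  assumes "prob_space M"
    and "k \<ge> 1" and "lam > 0"
    and "c\<^sub>1 \<ge> 0" and "c\<^sub>2 \<ge> 0" and "c\<^sub>1 + c\<^sub>2 = 1"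
    and "\<mu>\<^sub>1 > 0" and "\<mu>\<^sub>2 > 0"
    and "\<alpha>\<^sub>1 \<in> {0<..<1}" and "\<alpha>\<^sub>2 \<in> {0<..<1}"
    and "MTSS M c\<^sub>1 c\<^sub>2 \<alpha>\<^sub>1 \<alpha>\<^sub>2 \<mu>\<^sub>1 \<mu>\<^sub>2 S"
    and "E = first_exit S"
    and "TCPPoK M k lam H E Z Z2"
    and "Y \<in> borel_measurable M" and "cdf (distr M borel Y) = H"
    and "0 < s" and "s \<le> t"
  shows
    "(integrable M Y \<longrightarrow>
        integrable M (E t) \<and> integrable M (Z2 t) \<and>
        prob_space.expectation M (Z2 t) =
          real k * (real k + 1) / 2 * lam * prob_space.expectation M Y
            * prob_space.expectation M (E t)) \<and>
     (square_integrable M Y \<longrightarrow>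
        square_integrable M (Z 1) \<and>
        square_integrable M (E s) \<and> square_integrable M (E t) \<and>
        square_integrable M (Z2 s) \<and> square_integrable M (Z2 t) \<and>
        covariance M (Z2 s) (Z2 t) =
          prob_space.variance M (Z 1) * prob_space.expectation M (E s)
            + (prob_space.expectation M (Z 1))\<^sup>2 * covariance M (E s) (E t))"
proof -
  interpret prob_space M by fact
  \<comment> \<open>The Laplace exponent of \<open>S\<close> at \<open>u = 1\<close>; accordingly
    \<open>q\<close> is the expectation of exp(-S(1)) and \<open>q ^ n\<close> that of
    exp(-S(n)).\<close>
  define \<phi> where "\<phi> = c\<^sub>1 * ((1 + \<mu>\<^sub>1) powr \<alpha>\<^sub>1 - \<mu>\<^sub>1 powr \<alpha>\<^sub>1) + c\<^sub>2 * ((1 + \<mu>\<^sub>2) powr \<alpha>\<^sub>2 - \<mu>\<^sub>2 powr \<alpha>\<^sub>2)"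
  define q where "q = exp (- \<phi>)"
  \<comment> \<open>Powers with positive exponent are strictly increasing, and of the two weights
    with sum 1 at least one is positive.\<close>
  have "0 < \<phi>"
  proof -
    have "0 < (1 + \<mu>\<^sub>1) powr \<alpha>\<^sub>1 - \<mu>\<^sub>1 powr \<alpha>\<^sub>1" "0 < (1 + \<mu>\<^sub>2) powr \<alpha>\<^sub>2 - \<mu>\<^sub>2 powr \<alpha>\<^sub>2"
      using assms by (auto intro!: powr_less_mono2)
    moreover have "0 < c\<^sub>1 \<or> 0 < c\<^sub>2"
      using assms by linarith
    ultimately show ?thesis
      unfolding \<phi>_def using assms(4,5)
      by (elim disjE) (simp_all add: add_pos_nonneg add_nonneg_pos)
  qed
  then have q: "0 < q" "q < 1"
    by (auto simp: q_def)
  have S_meas: "S (real n) \<in> borel_measurable M" for n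
    using assms(11) by (simp add: MTSS_def subordinator_def levy_process_def)
  have laplace: "(\<integral>\<omega>. exp (- S (real n) \<omega>) \<partial>M) = q ^ n" for n
  proof -
    have "\<forall>t\<ge>0. \<forall>u>0. (\<integral>\<omega>. exp (- u * S t \<omega>) \<partial>M) =
        exp (- t * (c\<^sub>1 * ((u + \<mu>\<^sub>1) powr \<alpha>\<^sub>1 - \<mu>\<^sub>1 powr \<alpha>\<^sub>1) +
                    c\<^sub>2 * ((u + \<mu>\<^sub>2) powr \<alpha>\<^sub>2 - \<mu>\<^sub>2 powr \<alpha>\<^sub>2)))"
      using assms(11) by (simp add: MTSS_def)
    from this[rule_format, of "real n" 1, folded \<phi>_def] show ?thesis
      by (simp add: q_def exp_of_nat_mult[symmetric])
  qed
  have C: "CPPoK M k lam H Z" and ZE: "indep_families M {0..} Z {0..} E"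
    and Z2_meas: "\<And>t. 0 \<le> t \<Longrightarrow> Z2 t \<in> borel_measurable M"
    and Z2: "\<And>t \<omega>. 0 \<le> t \<Longrightarrow> \<omega> \<in> space M \<Longrightarrow> Z2 t \<omega> = Z (E t \<omega>) \<omega>"
    using assms(13) by (auto simp: TCPPoK_def)
  have s: "0 \<le> s" and t: "0 \<le> t" using assms by auto
  note ind = indep_families_imp_indep_pair[OF ZE]
  have "(\<lambda>x. (x s, x t)) \<in> PiM {0..} (\<lambda>_. borel) \<rightarrow>\<^sub>M (borel \<Otimes>\<^sub>M borel :: (real \<times> real) measure)"
    using s t by (intro measurable_Pair measurable_component_singleton) auto
  from indep_pair_compose[OF ind measurable_ident this]
  have ind_st: "indep_pair M (PiM {0..} (\<lambda>_. borel)) (\<lambda>\<omega>. \<lambda>r\<in>{0..}. Z r \<omega>) (borel \<Otimes>\<^sub>M borel) (\<lambda>\<omega>. (E s \<omega>, E t \<omega>))"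
    using s t by simp
  have ind_s: "indep_pair M (PiM {0..} (\<lambda>_. borel)) (\<lambda>\<omega>. \<lambda>r\<in>{0..}. Z r \<omega>) borel (E s)"
    and ind_t: "indep_pair M (PiM {0..} (\<lambda>_. borel)) (\<lambda>\<omega>. \<lambda>r\<in>{0..}. Z r \<omega>) borel (E t)"
    using indep_pair_compose[OF ind_st measurable_ident measurable_fst]
      indep_pair_compose[OF ind_st measurable_ident measurable_snd] by simp_all
  \<comment> \<open>Measurability of the exit times is read off from the independence of
    \<open>Z\<close> and \<open>E\<close>, whose definition contains it.\<close>
  have E_meas: "first_exit S s \<in> borel_measurable M" "first_exit S t \<in> borel_measurable M"
    using indep_pair_measurable(2)[OF ind_s] indep_pair_measurable(2)[OF ind_t] assms(12) by auto
  have E_sq: "square_integrable M (E s)" "square_integrable M (E t)"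
    unfolding assms(12) using E_meas by (auto intro!: first_exit_square_integrable[OF S_meas laplace q])
  have E_nonneg: "AE \<omega> in M. 0 \<le> E s \<omega>" "AE \<omega> in M. 0 \<le> E t \<omega>"
    unfolding assms(12) by (intro AE_first_exit_nonneg[OF S_meas laplace q])+
  have E_mono: "AE \<omega> in M. E s \<omega> \<le> E t \<omega>"
    unfolding assms(12) by (rule AE_first_exit_mono[OF S_meas laplace q assms(17)])
  note rc = CPPoK_right_continuous[OF C assms(2,3,14,15)]
  have ZE_meas: "(\<lambda>\<omega>. Z (E s \<omega>) \<omega>) \<in> borel_measurable M" "(\<lambda>\<omega>. Z (E t \<omega>) \<omega>) \<in> borel_measurable M"
    using Z2_meas[OF s] Z2_meas[OF t] Z2 s t by (auto cong: measurable_cong)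
  have Z2_int: "integrable M (Z2 r) \<longleftrightarrow> integrable M (\<lambda>\<omega>. Z (E r \<omega>) \<omega>)"
    "(\<integral>\<omega>. Z2 r \<omega> \<partial>M) = (\<integral>\<omega>. Z (E r \<omega>) \<omega> \<partial>M)" if "0 \<le> r" for r
    using Z2[OF that] by (auto intro!: Bochner_Integration.integrable_cong Bochner_Integration.integral_cong)
  have Z2_sq: "square_integrable M (Z2 r) \<longleftrightarrow> square_integrable M (\<lambda>\<omega>. Z (E r \<omega>) \<omega>)" if "0 \<le> r" for r
    unfolding square_integrable_def using Z2[OF that]
    by (intro conj_cong measurable_cong Bochner_Integration.integrable_cong) auto
  define m where "m = real k * (real k + 1) / 2 * lam * expectation Y"
  have mean: "integrable M (Z2 r)" "expectation (Z2 r) = m * expectation (E r)"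
    if Y: "integrable M Y" and r: "r \<in> {s, t}" for r
  proof -
    obtain C where lm: "linear_mean M Z m C"
      using CPPoK_linear_mean[OF C assms(2,3,14,15) Y] by (auto simp: m_def)
    show "integrable M (Z2 r)" "expectation (Z2 r) = m * expectation (E r)"
      using time_change_mean[OF ind_s rc E_nonneg(1) ZE_meas(1) lm square_integrable_integrable[OF E_sq(1)]]
        time_change_mean[OF ind_t rc E_nonneg(2) ZE_meas(2) lm square_integrable_integrable[OF E_sq(2)]]
        Z2_int r s t by auto
  qed
  have cov: "square_integrable M (Z 1) \<and> square_integrable M (Z2 s) \<and> square_integrable M (Z2 t) \<and>
        covariance M (Z2 s) (Z2 t) =
          variance (Z 1) * expectation (E s) + (expectation (Z 1))\<^sup>2 * covariance M (E s) (E t)"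
    if Y: "square_integrable M Y"
  proof -
    note Y_int = square_integrable_integrable[OF Y]
    obtain C where lm: "linear_mean M Z m C"
      using CPPoK_linear_mean[OF C assms(2,3,14,15) Y_int] by (auto simp: m_def)
    obtain A where lc: "linear_covariance M Z m A"
      using CPPoK_linear_covariance[OF C assms(2,3,14,15) Y] by (auto simp: m_def)
    \<comment> \<open>At time 1 the mean is \<open>m\<close> and the second moment is
      \<open>A + m\<^sup>2\<close>, which identifies \<open>A\<close> as the variance of
      \<open>Z 1\<close>.\<close>
    have Z1: "square_integrable M (Z 1)" "expectation (\<lambda>\<omega>. Z 1 \<omega> * Z 1 \<omega>) = A + m\<^sup>2" "expectation (Z 1) = m"
      using lm lc by (auto simp: linear_mean_def linear_covariance_def)
    have var: "variance (Z 1) = A"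
      using Z1 square_integrable_integrable[OF Z1(1)]
      by (subst variance_eq) (auto simp: square_integrable_def power2_eq_square)
    have sq: "square_integrable M (Z2 s)" "square_integrable M (Z2 t)"
      using time_change_square_integrable[OF ind_s rc E_nonneg(1) ZE_meas(1) lc E_sq(1)]
        time_change_square_integrable[OF ind_t rc E_nonneg(2) ZE_meas(2) lc E_sq(2)]
        Z2_sq s t by auto
    have "expectation (\<lambda>\<omega>. Z2 s \<omega> * Z2 t \<omega>) = expectation (\<lambda>\<omega>. Z (E s \<omega>) \<omega> * Z (E t \<omega>) \<omega>)"
      using Z2 s t by (intro Bochner_Integration.integral_cong) auto
    also have "\<dots> = A * expectation (E s) + m\<^sup>2 * expectation (\<lambda>\<omega>. E s \<omega> * E t \<omega>)"
      by (rule time_change_product[OF ind_st rc E_nonneg(1) E_mono ZE_meas lc E_sq])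
    \<comment> \<open>Both means are \<open>m\<close> times those of \<open>E s\<close> and
      \<open>E t\<close>, so subtracting their product turns the product moment of the exit times
      into their covariance.\<close>
    finally have "covariance M (Z2 s) (Z2 t) = A * expectation (E s) + m\<^sup>2 * covariance M (E s) (E t)"
      using mean[OF Y_int] by (simp add: covariance_eq[OF sq] covariance_eq[OF E_sq] algebra_simps power2_eq_square)
    then show ?thesis
      using Z1 sq var by simp
  qed
  show ?thesis
    using mean[of t] cov E_sq square_integrable_integrable[OF E_sq(2)] by (auto simp: m_def)
qed

end
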